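(* Let $X\subset\mathbb{R}$ be either a finite set or a compact interval $[\underline x,\bar x]$, let $\Delta(X)$ be the set of Borel probability measures on $X$ with the weak$^*$ topology, and let $\Theta=[\underline\theta,\bar\theta]$. Let $u:\mathbb{R}\to\mathbb{R}$ be strictly increasing, continuous and weakly concave. Let $C:\Theta\times\Delta(X)\to\mathbb{R}$ be bounded, with $C(\theta,\cdot)$ weak$^*$-continuous and convex for every $\theta$, and satisfying: (i) for every $\theta$, if $\mu'$ first-order stochastically dominates $\mu$ then $C(\theta,\mu')\ge C(\theta,\mu)$; (ii) for every $(\theta,\mu)$ there is a continuous $c_\mu(\theta,\cdot):X\to\mathbb{R}$ with $\lim_{\varepsilon\searrow0}\big(C(\theta,(1-\varepsilon)\mu+\varepsilon\mu')-C(\theta,\mu)\big)/\varepsilon=\int_X c_\mu(\theta,x)\,[\mu'-\mu](\mathrm{d}x)$ for all $\mu'\in\Delta(X)$; (iii) for every $\mu$, $C(\cdot,\mu)$ is strictly decreasing and continuously differentiable, and for every $\theta$, $\sup_{\mu\in\Delta(X)}|\partial C(\theta,\mu)/\partial\theta|<\infty$. For a wage $w:X\to\mathbb{R}$ define $U(\theta,w,\mu)=\int_X u(w(x))\,\mu(\mathrm{d}x)-C(\theta,\mu)$. Let $\{w_\theta,\mu_\theta\}_{\theta\in\Theta}$ be a mechanism in which each $w_\theta:X\to\mathbb{R}$ is measurable, bounded above, non-decreasing and right-continuous, and each $\mu_\theta\in\Delta(X)$. Call it incentive compatible if $U(\theta,w_\theta,\mu_\theta)\ge U(\theta,w_{\hat\theta},\mu')$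 for all $\theta,\hat\theta\in\Theta$ and all $\mu'\in\Delta(X)$. Then the mechanism is incentive compatible if and only if there exist a family $\{\mu_{\theta,\hat\theta}\}_{(\theta,\hat\theta)\in\Theta^2}\subset\Delta(X)$ with $\mu_{\theta,\theta}=\mu_\theta$ for all $\theta$, and an absolutely continuous function $V:\Theta\to\mathbb{R}$ with $V(\theta)=U(\theta,w_\theta,\mu_\theta)$ for all $\theta$, such that for all $\theta\in\Theta$: 1. (Envelope) $V(\theta)=V(\underline\theta)-\int_{\underline\theta}^{\theta}\frac{\partial C}{\partial\theta}(t,\mu_t)\,\mathrm{d}t$; 2. (Generalized monotonicity) $\int_{\hat\theta}^{\theta}\Big[-\frac{\partial C}{\partial\theta}(t,\mu_t)+\frac{\partial C}{\partial\theta}(t,\mu_{t,\hat\theta})\Big]\mathrm{d}t\ge0$ for all $\hat\theta\in\Theta$; 3. (On-path obedience) $w_\theta(x)\le u^{-1}\Big(c_{\mu_\theta}(\theta,x)+V(\theta)+C(\theta,\mu_\theta)-\int_X c_{\mu_\theta}(\theta,y)\,\mu_\theta(\mathrm{d}y)\Big)$ for all $x\in X$, with equality for $\mu_\theta$-almost all $x\in X$; 4. (Off-path obedience) $\mu_{\theta,\hat\theta}\in\arg\max_{\nu\in\Delta(X)}\int_X\big[u(w_{\hat\theta}(x))-c_{\mu_{\theta,\hat\theta}}(\theta,x)\big]\,\nu(\mathrm{d}x)$ for all $\hat\theta\neq\theta$.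
   Context: Here $\partial C(t,\mu)/\partial\theta$ denotes the derivative of $C$ with respect to its first (type) argument evaluated at $t$. The family $\{\mu_{\theta,\hat\theta}\}$ (a "generalized recommendation schedule") is interpreted as the output distribution recommended to an agent of true type $\theta$ who reports $\hat\theta$ and thus receives contract $w_{\hat\theta}$. $u^{-1}$ is the inverse of the strictly increasing function $u$. *)

theory Defs
  imports "HOL-Probability.Probability"
begin

definition Delta :: "real set \<Rightarrow> real measure set" where
  "Delta X = {M. sets M = sets (restrict_space borel X) \<and> prob_space M}"

definition mix :: "real set \<Rightarrow> real \<Rightarrow> real measure \<Rightarrow> real measure \<Rightarrow> real measure" where
  "mix X a M N = measure_of X (sets (restrict_space borel X))
     (\<lambda>A. ennreal (1 - a) * emeasure M A + ennreal a * emeasure N A)"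

text \<open>Weak* convergence of a sequence of measures on the compact set X
  (the weak* topology on Delta(X) is metrizable, so sequential notions suffice).\<close>
definition weak_conv_on :: "real set \<Rightarrow> (nat \<Rightarrow> real measure) \<Rightarrow> real measure \<Rightarrow> bool" where
  "weak_conv_on X Ms M \<longleftrightarrow>
     (\<forall>f::real \<Rightarrow> real. continuous_on X f \<longrightarrow> (\<lambda>n. \<integral>x. f x \<partial>(Ms n)) \<longlonglongrightarrow> (\<integral>x. f x \<partial>M))"

definition fosd :: "real set \<Rightarrow> real measure \<Rightarrow> real measure \<Rightarrow> bool" where
  "fosd X N M \<longleftrightarrow> (\<forall>t. measure N {x\<in>X. x \<le> t} \<le> measure M {x\<in>X. x \<le> t})"

definition abs_cont_on :: "real \<Rightarrow> real \<Rightarrow> (real \<Rightarrow> real) \<Rightarrow> bool" where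
  "abs_cont_on a b f \<longleftrightarrow>
     (\<forall>\<epsilon>>0. \<exists>\<delta>>0. \<forall>(n::nat) (l::nat \<Rightarrow> real) r.
        (\<forall>i<n. a \<le> l i \<and> l i \<le> r i \<and> r i \<le> b) \<and>
        (\<forall>i<n. \<forall>j<n. i \<noteq> j \<longrightarrow> r i \<le> l j \<or> r j \<le> l i) \<and>
        (\<Sum>i<n. r i - l i) < \<delta>
        \<longrightarrow> (\<Sum>i<n. \<bar>f (r i) - f (l i)\<bar>) < \<epsilon>)"

definition Util :: "(real \<Rightarrow> real) \<Rightarrow> (real \<Rightarrow> real measure \<Rightarrow> real)
    \<Rightarrow> real \<Rightarrow> (real \<Rightarrow> real) \<Rightarrow> real measure \<Rightarrow> real" where
  "Util u C \<theta> w M = (\<integral>x. u (w x) \<partial>M) - C \<theta> M"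

end

theory Submission
  imports Defs
begin

text \<open>Both the truthful value \<open>V\<close> and, for a fixed report \<open>\<theta>'\<close>, the value
  \<open>W t = max\<^sub>\<nu> U(t, w\<^bsub>\<theta>'\<^esub>, \<nu>)\<close> satisfy
  \<open>W t - W s \<le> C(s, \<nu>\<^sub>t) - C(t, \<nu>\<^sub>t)\<close>, where \<open>\<nu>\<^sub>t\<close> is the measure chosen by type \<open>t\<close>. This alone yields the
  envelope formula: weak compactness of the measures makes \<open>W\<close> continuous; \<open>W\<close> is nondecreasing and its left difference
  quotients at \<open>t\<close> are bounded, since those of \<open>C(\<cdot>, \<nu>\<^sub>t)\<close> are, so \<open>W\<close> maps null sets to
  null sets and its Stieltjes measure has a density; the density is minus the type derivative of
  \<open>C\<close> at \<open>\<nu>\<^sub>t\<close> almost everywhere. Given the two envelope formulas, generalized monotonicity says exactly that \<open>V\<close> dominates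
  every \<open>W\<close>. Obedience is the first-order condition for maximizing a concave functional over measures, and
  maximizers exist because a nondecreasing right-continuous wage is upper semicontinuous.\<close>

section \<open>Absolutely continuous Stieltjes measures\<close>

text \<open>The preimage of an open interval is squeezed between closed ones: surjectivity supplies
  points where \<open>F\<close> takes values at or just inside the ends, and continuity makes the
  mass of a closed interval the increase of \<open>F\<close> over it. Flat stretches of
  \<open>F\<close> carry no mass, so \<open>F\<close> may fail to be injective.\<close>

lemma distr_interval_measure_lborel:
  fixes F :: "real \<Rightarrow> real"
  assumes mono: "\<And>x y. x \<le> y \<Longrightarrow> F x \<le> F y" and cont: "continuous_on UNIV F" and surj: "surj F"
  shows "distr (interval_measure F) borel F = lborel"
proof (rule lborel_eqI[symmetric])
  fix l u :: real assume "\<And>b. b \<in> Basis \<Longrightarrow> l \<bullet> b \<le> u \<bullet> b"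
  then have lu: "l \<le> u" by simp
  have [measurable]: "F \<in> borel_measurable borel"
    using cont by (rule borel_measurable_continuous_onI)
  let ?S = "F -` {l<..<u}"
  have S[measurable]: "?S \<in> sets borel"
    using measurable_sets_borel[of F borel "{l<..<u}"] by simp
  have Icc: "emeasure (interval_measure F) {p..q} = ennreal (F q - F p)" if "p \<le> q" for p q
    using emeasure_interval_measure_Icc[OF that mono cont] .
  have upper: "emeasure (interval_measure F) ?S \<le> ennreal (u - l)"
  proof -
    obtain p q where p: "F p = l" "F q = u" using surj by (metis surjD)
    \<comment> \<open>For l = u the chosen points may come in the wrong order; the minimum repairs
      that.\<close>
    have "?S \<subseteq> {min p q..q}"
      using p mono by (auto simp: not_le min_def) (meson leD le_less_linear less_imp_le)+
    then have "emeasure (interval_measure F) ?S \<le> emeasure (interval_measure F) {min p q..q}"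
      by (intro emeasure_mono) auto
    also have "\<dots> = ennreal (F q - F (min p q))" by (intro Icc) auto
    also have "\<dots> \<le> ennreal (u - l)"
      using p lu mono by (auto simp: min_def intro!: ennreal_leI)
    finally show ?thesis .
  qed
  have lower: "ennreal (u - l) \<le> emeasure (interval_measure F) ?S"
  proof (rule ennreal_le_epsilon)
    fix e :: real assume e: "0 < e"
    show "ennreal (u - l) \<le> emeasure (interval_measure F) ?S + ennreal e"
    proof (cases "u - l \<le> e")
      case True
      then have "ennreal (u - l) \<le> ennreal e" by (rule ennreal_leI)
      also have "\<dots> \<le> emeasure (interval_measure F) ?S + ennreal e" by simp
      finally show ?thesis .
    next
      case False
      \<comment> \<open>Retreating by e/2 at both ends puts a closed interval inside the preimage of
        the open one, at a total loss of e; the two values are in order because u - l > e.\<close>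
      obtain p q where p: "F p = l + e/2" "F q = u - e/2" using surj by (metis surjD)
      have pq: "p \<le> q" using mono[of q p] p False by linarith
      have "{p..q} \<subseteq> ?S" using p e mono[of p] mono[of _ q] by force
      then have "emeasure (interval_measure F) {p..q} \<le> emeasure (interval_measure F) ?S"
        by (intro emeasure_mono) auto
      then have "ennreal (u - l - e) \<le> emeasure (interval_measure F) ?S"
        using Icc[OF pq] unfolding p by (simp add: algebra_simps)
      then have "ennreal (u - l - e) + ennreal e \<le> emeasure (interval_measure F) ?S + ennreal e"
        by (rule add_right_mono)
      then show ?thesis using False e by (simp flip: ennreal_plus)
    qed
  qed
  show "emeasure (distr (interval_measure F) borel F) (box l u) = ennreal (\<Prod>b\<in>Basis. (u - l) \<bullet> b)"
    using upper lower by (auto simp: emeasure_distr box_real intro: antisym)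
qed simp

text \<open>By the push-forward identity the Stieltjes mass of a set is at most the Lebesgue measure
  of any Borel set containing its image, and Lusin's condition makes the image of a null set
  null.\<close>

lemma absolutely_continuous_interval_measure:
  fixes F :: "real \<Rightarrow> real"
  assumes mono: "\<And>x y. x \<le> y \<Longrightarrow> F x \<le> F y" and cont: "continuous_on UNIV F" and surj: "surj F"
    and lusin: "\<And>S. negligible S \<Longrightarrow> negligible (F ` S)"
  shows "absolutely_continuous lborel (interval_measure F)"
  unfolding absolutely_continuous_def
proof
  fix A :: "real set" assume A: "A \<in> null_sets lborel"
  have [measurable]: "F \<in> borel_measurable borel"
    using cont by (rule borel_measurable_continuous_onI)
  have "A \<in> null_sets lebesgue" using A by (rule null_sets_completionI)
  then have "negligible (F ` A)" using lusin by (simp add: negligible_iff_null_sets)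
  \<comment> \<open>The image need not be Borel, so a Borel null superset takes its place.\<close>
  then obtain Z where Z: "Z \<in> null_sets lborel" "F ` A \<subseteq> Z"
    unfolding negligible_iff_null_sets null_sets_completion_iff2 by auto
  have "emeasure (interval_measure F) A \<le> emeasure (interval_measure F) (F -` Z)"
    using Z measurable_sets_borel[of F borel Z] by (intro emeasure_mono) auto
  also have "\<dots> = emeasure (distr (interval_measure F) borel F) Z"
    using Z by (subst emeasure_distr) auto
  also have "\<dots> = 0" using Z distr_interval_measure_lborel[OF mono cont surj] by auto
  finally show "A \<in> null_sets (interval_measure F)" using A by (auto simp: null_sets_def)
qed

text \<open>Radon-Nikodym with a real-valued density. The increments appear both as Lebesgue
  integrals, which serve absolute continuity, and as gauge integrals, which serve differentiation
  and the envelope formula.\<close>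

lemma interval_measure_density:
  fixes F :: "real \<Rightarrow> real"
  assumes mono: "\<And>x y. x \<le> y \<Longrightarrow> F x \<le> F y" and cont: "continuous_on UNIV F"
    and ac: "absolutely_continuous lborel (interval_measure F)"
  obtains f where "f \<in> borel_measurable borel" "\<And>x. 0 \<le> f x"
    "\<And>a b. a \<le> b \<Longrightarrow> set_integrable lborel {a..b} f"
    "\<And>a b. a \<le> b \<Longrightarrow> (LINT x:{a<..b}|lborel. f x) = F b - F a"
    "\<And>a b. a \<le> b \<Longrightarrow> (f has_integral (F b - F a)) {a..b}"
proof -
  let ?N = "interval_measure F"
  have rc: "continuous (at_right a) F" for a
    using cont by (simp add: continuous_at_imp_continuous_within continuous_on_eq_continuous_at)
  have sf: "sigma_finite_measure ?N" by (rule sigma_finite_interval_measure[OF mono rc])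
  define h where "h = RN_deriv lborel ?N"
  define f where "f x = enn2real (h x)" for x
  have hm[measurable]: "h \<in> borel_measurable borel" unfolding h_def
    using borel_measurable_RN_deriv[of lborel ?N] by simp
  have fm[measurable]: "f \<in> borel_measurable borel" unfolding f_def by measurable
  have dens: "density lborel h = ?N"
    unfolding h_def by (rule sigma_finite_measure.density_RN_deriv[OF sigma_finite_lborel ac]) simp
  \<comment> \<open>\<open>enn2real\<close> sends infinity to 0; sigma-finiteness of the Stieltjes
    measure makes the density finite almost everywhere, so nothing is lost.\<close>
  have fin: "AE x in lborel. h x = ennreal (f x)"
    using sigma_finite_measure.RN_deriv_finite[OF sigma_finite_lborel sf ac] unfolding f_def h_def by (auto simp: less_top)
  have f0: "0 \<le> f x" for x by (simp add: f_def)
  have hb: "has_bochner_integral lborel (\<lambda>x. indicator A x * f x) r"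
    if A[measurable]: "A \<in> sets borel" and r: "emeasure ?N A = ennreal r" "0 \<le> r" for A r
  proof (rule has_bochner_integral_nn_integral)
    have "ennreal r = emeasure (density lborel h) A" unfolding dens using r by simp
    also have "\<dots> = (\<integral>\<^sup>+x. h x * indicator A x \<partial>lborel)" by (rule emeasure_density) auto
    also have "\<dots> = (\<integral>\<^sup>+x. ennreal (indicator A x * f x) \<partial>lborel)"
      using fin by (intro nn_integral_cong_AE) (auto split: split_indicator elim!: eventually_mono)
    finally show "(\<integral>\<^sup>+x. ennreal (indicator A x * f x) \<partial>lborel) = ennreal r" by simp
  qed (use f0 r in auto)
  have hcc: "has_bochner_integral lborel (\<lambda>x. indicator {a..b} x * f x) (F b - F a)" if "a \<le> b" for a b
    using mono[OF that] by (intro hb emeasure_interval_measure_Icc[OF that mono cont]) auto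
  have hoc: "has_bochner_integral lborel (\<lambda>x. indicator {a<..b} x * f x) (F b - F a)" if "a \<le> b" for a b
    using mono[OF that] by (intro hb emeasure_interval_measure_Ioc[OF that mono rc]) auto
  have si: "set_integrable lborel {a..b} f" if "a \<le> b" for a b
    using hcc[OF that] by (auto simp: set_integrable_def has_bochner_integral_iff)
  moreover have "(LINT x:{a<..b}|lborel. f x) = F b - F a" if "a \<le> b" for a b
    using hoc[OF that] by (auto simp: set_lebesgue_integral_def has_bochner_integral_iff)
  moreover have "(f has_integral (F b - F a)) {a..b}" if "a \<le> b" for a b
    using set_borel_integral_eq_integral[OF si[OF that]] hcc[OF that]
    by (auto simp: set_lebesgue_integral_def has_bochner_integral_iff has_integral_iff)
  ultimately show thesis using that fm f0 by blast
qed

text \<open>The Lebesgue differentiation theorem, in the one-sided form that the envelope argument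
  compares with right difference quotients.\<close>

lemma right_derivative_integral_ae:
  fixes f :: "real \<Rightarrow> real"
  assumes "\<And>a b. a \<le> b \<Longrightarrow> (f has_integral (F b - F a)) {a..b}"
  obtains N where "negligible N"
    "\<And>x. x \<notin> N \<Longrightarrow> ((\<lambda>h. (F (x + h) - F x) / h) \<longlongrightarrow> f x) (at_right 0)"
proof -
  have "f integrable_on cbox a b" for a b
    using assms[of a b] by (cases "a \<le> b") (auto simp: integrable_on_def)
  then obtain N where N: "negligible N" and
    lim: "\<And>x e. \<lbrakk>x \<notin> N; 0 < e\<rbrakk> \<Longrightarrow> \<exists>d>0. \<forall>h. 0 < h \<and> h < d \<longrightarrow>
            norm(integral (cbox x (x + h *\<^sub>R One)) f /\<^sub>R h ^ DIM(real) - f x) < e"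
    by (rule integrable_ccontinuous_explicit[of f]) blast+
  have "((\<lambda>h. (F (x + h) - F x) / h) \<longlongrightarrow> f x) (at_right 0)" if x: "x \<notin> N" for x
  proof (rule tendstoI)
    fix e :: real assume "0 < e"
    then obtain d where d: "d > 0" "\<And>h. 0 < h \<Longrightarrow> h < d \<Longrightarrow>
        norm(integral (cbox x (x + h *\<^sub>R One)) f /\<^sub>R h ^ DIM(real) - f x) < e"
      using lim[OF x] by blast
    have "dist ((F (x + h) - F x) / h) (f x) < e" if "0 < h" "h < d" for h
      using d(2)[OF that] integral_unique[OF assms[of x "x + h"]] that
      by (simp add: dist_real_def divide_inverse mult.commute)
    then show "\<forall>\<^sub>F h in at_right 0. dist ((F (x + h) - F x) / h) (f x) < e"
      using d(1) by (auto simp: eventually_at_right_field)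
  qed
  with N show thesis using that by blast
qed

text \<open>Reflection turns left quotients into right ones; the exceptional set is reflected too
  and stays null because reflection is Lipschitz.\<close>

lemma left_derivative_integral_ae:
  fixes f :: "real \<Rightarrow> real"
  assumes "\<And>a b. a \<le> b \<Longrightarrow> (f has_integral (F b - F a)) {a..b}"
  obtains N where "negligible N"
    "\<And>x. x \<notin> N \<Longrightarrow> ((\<lambda>h. (F x - F (x - h)) / h) \<longlongrightarrow> f x) (at_right 0)"
proof -
  have "((\<lambda>x. f (- x)) has_integral (- F (- b) - - F (- a))) {a..b}" if "a \<le> b" for a b
  proof -
    have "((\<lambda>x. f (- x)) has_integral (- F (- b) - - F (- a))) {- (- a)..- (- b)}"
      using assms[of "-b" "-a"] that by (subst has_integral_reflect_real) auto
    then show ?thesis by simp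
  qed
  then obtain N where N: "negligible N"
    "\<And>x. x \<notin> N \<Longrightarrow> ((\<lambda>h. (- F (- (x + h)) - - F (- x)) / h) \<longlongrightarrow> f (- x)) (at_right 0)"
    by (rule right_derivative_integral_ae[of "\<lambda>x. f (- x)" "\<lambda>x. - F (- x)"]) blast+
  have "negligible (uminus ` N)"
  proof (rule negligible_locally_Lipschitz_image)
    show "\<exists>T B. open T \<and> x \<in> T \<and> (\<forall>y\<in>N \<inter> T. norm (- y - - x) \<le> B * norm (y - x))" for x
      by (intro exI[of _ UNIV] exI[of _ 1]) auto
  qed (use N(1) in auto)
  moreover have "((\<lambda>h. (F x - F (x - h)) / h) \<longlongrightarrow> f x) (at_right 0)" if "x \<notin> uminus ` N" for x
  proof -
    have "- x \<notin> N" using that by (metis image_eqI minus_minus)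
    from N(2)[OF this] show ?thesis by (simp add: algebra_simps)
  qed
  ultimately show thesis using that by blast
qed

text \<open>The constants L and d depend on the point, but countably many sets \<open>E n\<close>
  with uniform constants cover all points except z. Between two close points of the same
  \<open>E n\<close> the bound at the larger one, together with monotonicity, makes \<open>F\<close>
  Lipschitz. Lipschitz images of null sets are null, and z adds a single value.\<close>

lemma negligible_image_left_Lipschitz:
  fixes F :: "real \<Rightarrow> real"
  assumes mono: "\<And>x y. x \<le> y \<Longrightarrow> F x \<le> F y"
    and left: "\<And>x. x \<noteq> z \<Longrightarrow> \<exists>L d. 0 < d \<and> (\<forall>t. x - d < t \<and> t \<le> x \<longrightarrow> F x - F t \<le> L * (x - t))"
    and S: "negligible S"
  shows "negligible (F ` S)"
proof -
  \<comment> \<open>\<open>Suc n\<close> keeps the radius positive at n = 0.\<close>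
  define E where "E n = {x. \<forall>t. x - 1 / real (Suc n) < t \<and> t \<le> x \<longrightarrow> F x - F t \<le> real n * (x - t)}" for n
  have cover: "\<exists>n. x \<in> E n" if "x \<noteq> z" for x
  proof -
    obtain L d where d: "0 < d" "\<And>t. x - d < t \<Longrightarrow> t \<le> x \<Longrightarrow> F x - F t \<le> L * (x - t)"
      using left[OF \<open>x \<noteq> z\<close>] by blast
    \<comment> \<open>One n exceeds the slope and the inverse radius at once.\<close>
    obtain n where n: "max L (1 / d) < real n" using reals_Archimedean2 by blast
    have "1 / real (Suc n) < d" using n d(1) by (simp add: field_simps)
    moreover have "L * (x - t) \<le> real n * (x - t)" if "t \<le> x" for t
      using n that by (intro mult_right_mono) auto
    ultimately have "F x - F t \<le> real n * (x - t)" if "x - 1 / real (Suc n) < t" "t \<le> x" for t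
      using d(2)[of t] that by (smt (verit))
    then have "x \<in> E n" unfolding E_def by blast
    then show ?thesis ..
  qed
  have "negligible (F ` (S \<inter> E n))" for n
  proof (rule negligible_locally_Lipschitz_image)
    show "negligible (S \<inter> E n)" using S by (rule negligible_Int[OF disjI1])
    fix x assume x: "x \<in> S \<inter> E n"
    have "norm (F y - F x) \<le> real n * norm (y - x)" if "y \<in> S \<inter> E n \<inter> ball x (1 / real (Suc n))" for y
    proof (cases "y \<le> x")
      case True
      have "F x - F y \<le> real n * (x - y)"
        using x that True unfolding E_def by (auto simp: dist_real_def)
      then show ?thesis using True mono[OF True] by simp
    next
      case False
      have "F y - F x \<le> real n * (y - x)"
        using that False unfolding E_def by (auto simp: dist_real_def)
      then show ?thesis using False mono[of x y] by simp
    qed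
    then show "\<exists>T B. open T \<and> x \<in> T \<and> (\<forall>y\<in>S \<inter> E n \<inter> T. norm (F y - F x) \<le> B * norm (y - x))"
      by (intro exI[of _ "ball x (1 / real (Suc n))"] exI[of _ "real n"]) auto
  qed simp
  then have "negligible (\<Union>n. F ` (S \<inter> E n))" by (intro negligible_countable_Union) auto
  then have "negligible (insert (F z) (\<Union>n. F ` (S \<inter> E n)))" by simp
  then show ?thesis
  proof (rule negligible_subset)
    show "F ` S \<subseteq> insert (F z) (\<Union>n. F ` (S \<inter> E n))"
    proof (rule image_subsetI)
      fix x assume "x \<in> S"
      with cover[of x] show "F x \<in> insert (F z) (\<Union>n. F ` (S \<inter> E n))"
        by (cases "x = z") auto
    qed
  qed
qed

text \<open>Cut f at a height k. By dominated convergence the excess \<open>h k\<close> above a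
  large k has integral below e/2, and the part below k contributes at most k times the total length
  of the intervals.\<close>

lemma abs_cont_on_indefinite_integral:
  fixes f :: "real \<Rightarrow> real"
  assumes fm[measurable]: "f \<in> borel_measurable borel" and f0: "\<And>x. 0 \<le> f x"
    and fi: "set_integrable lborel {lo..hi} f"
    and W: "\<And>a b. \<lbrakk>lo \<le> a; a \<le> b; b \<le> hi\<rbrakk> \<Longrightarrow> W b - W a = (LINT x:{a<..b}|lborel. f x)"
  shows "abs_cont_on lo hi W"
  unfolding abs_cont_on_def
proof (intro allI impI)
  fix e :: real assume e: "0 < e"
  define h where "h k x = indicator {lo..hi} x * max 0 (f x - real k)" for k :: nat and x
  have hm[measurable]: "h k \<in> borel_measurable borel" for k unfolding h_def by measurable
  have fi': "integrable lborel (\<lambda>x. indicator {lo..hi} x * f x)"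
    using fi by (simp add: set_integrable_def)
  have hi: "integrable lborel (h k)" for k
    by (rule Bochner_Integration.integrable_bound[OF fi']) (auto simp: h_def f0 split: split_indicator)
  have "(\<lambda>k. \<integral>x. h k x \<partial>lborel) \<longlonglongrightarrow> (\<integral>x. 0 \<partial>(lborel::real measure))"
  proof (rule integral_dominated_convergence[OF _ _ fi'])
    show "AE x in lborel. (\<lambda>k. h k x) \<longlonglongrightarrow> 0"
    proof (rule AE_I2)
      fix x
      obtain m where "f x < real m" using reals_Archimedean2 by blast
      then have "\<forall>\<^sub>F k in sequentially. h k x = 0"
        unfolding eventually_sequentially h_def by (intro exI[of _ m]) auto
      then show "(\<lambda>k. h k x) \<longlonglongrightarrow> 0" by (rule tendsto_eventually)
    qed
    show "AE x in lborel. norm (h k x) \<le> indicator {lo..hi} x * f x" for k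
      by (auto simp: h_def f0 split: split_indicator)
  qed auto
  then have "\<forall>\<^sub>F k in sequentially. (\<integral>x. h k x \<partial>lborel) < e / 2"
    using e by (intro order_tendstoD(2)[of _ 0]) auto
  then obtain k where k: "(\<integral>x. h k x \<partial>lborel) < e / 2"
    by (auto simp: eventually_sequentially)
  show "\<exists>d>0. \<forall>(n::nat) l r. (\<forall>i<n. lo \<le> l i \<and> l i \<le> r i \<and> r i \<le> hi) \<and>
        (\<forall>i<n. \<forall>j<n. i \<noteq> j \<longrightarrow> r i \<le> l j \<or> r j \<le> l i) \<and> (\<Sum>i<n. r i - l i) < d
        \<longrightarrow> (\<Sum>i<n. \<bar>W (r i) - W (l i)\<bar>) < e"
  \<comment> \<open>A total length below this bound keeps the bounded part within e/2; k + 1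
    replaces k so that the denominator is positive at k = 0.\<close>
  proof (intro exI[of _ "e / (2 * (real k + 1))"] conjI allI impI)
    show "0 < e / (2 * (real k + 1))" using e by simp
    fix n and l r :: "nat \<Rightarrow> real"
    assume "(\<forall>i<n. lo \<le> l i \<and> l i \<le> r i \<and> r i \<le> hi) \<and>
        (\<forall>i<n. \<forall>j<n. i \<noteq> j \<longrightarrow> r i \<le> l j \<or> r j \<le> l i) \<and>
        (\<Sum>i<n. r i - l i) < e / (2 * (real k + 1))"
    then have lr: "\<forall>i<n. lo \<le> l i \<and> l i \<le> r i \<and> r i \<le> hi"
      and disj: "\<forall>i<n. \<forall>j<n. i \<noteq> j \<longrightarrow> r i \<le> l j \<or> r j \<le> l i"
      and small: "(\<Sum>i<n. r i - l i) < e / (2 * (real k + 1))"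
      by blast+
    define A where "A i = {l i<..r i}" for i
    have sub: "A i \<subseteq> {lo..hi}" if "i < n" for i using lr that unfolding A_def by force
    have [measurable]: "A i \<in> sets borel" for i by (simp add: A_def)
    have iA: "integrable lborel (\<lambda>x. indicator (A i) x * f x)" if "i < n" for i
      using set_integrable_subset[OF fi, of "A i"] sub[OF that] by (simp add: set_integrable_def)
    have iH: "integrable lborel (\<lambda>x. indicator (A i) x * h k x)" for i
      using integrable_mult_indicator[OF _ hi, of "A i" k] by simp
    have iK: "integrable lborel (\<lambda>x. indicator (A i) x * real k)" for i
      by (rule integrable_mult_left, cases "l i \<le> r i") (auto simp: A_def intro!: integrable_real_indicator)
    \<comment> \<open>Half-open intervals that meet only at endpoints are disjoint, so at most one
      summand is nonzero at x.\<close>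
    have ind: "(\<Sum>i<n. indicator (A i) x * h k x) \<le> h k x" for x
    proof (cases "\<exists>i<n. x \<in> A i")
      case True
      then obtain i where i: "i < n" "x \<in> A i" by blast
      have "x \<notin> A j" if "j < n" "j \<noteq> i" for j
        using disj that i unfolding A_def by fastforce
      then have "(\<Sum>j<n. indicator (A j) x * h k x) = (\<Sum>j\<in>{i}. indicator (A j) x * h k x)"
        using i by (intro sum.mono_neutral_right) (auto simp: indicator_def)
      also have "\<dots> = h k x" using i by simp
      finally show ?thesis by (rule eq_refl)
    next
      case False
      then have "(\<Sum>j<n. indicator (A j) x * h k x) = 0" by (intro sum.neutral) auto
      moreover have "0 \<le> h k x" by (simp add: h_def)
      ultimately show ?thesis by linarith
    qed
    have "(\<Sum>i<n. \<bar>W (r i) - W (l i)\<bar>) = (\<Sum>i<n. \<integral>x. indicator (A i) x * f x \<partial>lborel)"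
    proof (rule sum.cong[OF refl])
      fix i assume "i \<in> {..<n}"
      then have "W (r i) - W (l i) = (\<integral>x. indicator (A i) x * f x \<partial>lborel)"
        using W[of "l i" "r i"] lr by (simp add: set_lebesgue_integral_def A_def)
      moreover have "0 \<le> (\<integral>x. indicator (A i) x * f x \<partial>lborel)"
        using f0 by (intro integral_nonneg_AE) auto
      ultimately show "\<bar>W (r i) - W (l i)\<bar> = (\<integral>x. indicator (A i) x * f x \<partial>lborel)" by simp
    qed
    also have "\<dots> \<le> (\<Sum>i<n. (\<integral>x. indicator (A i) x * real k + indicator (A i) x * h k x \<partial>lborel))"
    proof (rule sum_mono)
      fix i assume i: "i \<in> {..<n}"
      show "(\<integral>x. indicator (A i) x * f x \<partial>lborel)
          \<le> (\<integral>x. indicator (A i) x * real k + indicator (A i) x * h k x \<partial>lborel)"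
        using i sub[of i] iA[of i] iH[of i] iK[of i]
        by (intro integral_mono) (auto simp: h_def split: split_indicator)
    qed
    also have "\<dots> = (\<Sum>i<n. (r i - l i) * real k) + (\<Sum>i<n. \<integral>x. indicator (A i) x * h k x \<partial>lborel)"
      unfolding sum.distrib[symmetric]
    proof (rule sum.cong[OF refl])
      fix i assume "i \<in> {..<n}"
      then have "(\<integral>x. indicator (A i) x * real k \<partial>lborel) = (r i - l i) * real k"
        using lr by (simp add: A_def)
      then show "(\<integral>x. indicator (A i) x * real k + indicator (A i) x * h k x \<partial>lborel)
          = (r i - l i) * real k + (\<integral>x. indicator (A i) x * h k x \<partial>lborel)"
        using Bochner_Integration.integral_add[OF iK iH] by metis
    qed
    also have "(\<Sum>i<n. \<integral>x. indicator (A i) x * h k x \<partial>lborel)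
        = (\<integral>x. (\<Sum>i<n. indicator (A i) x * h k x) \<partial>lborel)"
      by (rule Bochner_Integration.integral_sum[symmetric, OF iH])
    also have "\<dots> \<le> (\<integral>x. h k x \<partial>lborel)"
      by (rule integral_mono[OF Bochner_Integration.integrable_sum[OF iH] hi ind])
    also have "(\<Sum>i<n. (r i - l i) * real k) = real k * (\<Sum>i<n. r i - l i)"
      by (simp add: sum_distrib_left mult.commute)
    also have "\<dots> \<le> (real k + 1) * (\<Sum>i<n. r i - l i)"
      using lr by (intro mult_right_mono sum_nonneg) auto
    also have "\<dots> \<le> e / 2" using small by (simp add: field_simps)
    finally show "(\<Sum>i<n. \<bar>W (r i) - W (l i)\<bar>) < e" using k by simp
  qed
qed

section \<open>Probability measures on a compact set\<close>

lemma Delta_sets: "M \<in> Delta X \<Longrightarrow> sets M = sets (restrict_space borel X)"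
  and Delta_prob_space: "M \<in> Delta X \<Longrightarrow> prob_space M"
  by (auto simp: Delta_def)

lemma Delta_space: "M \<in> Delta X \<Longrightarrow> space M = X"
  using sets_eq_imp_space_eq[of M "restrict_space borel X"]
  by (simp add: Delta_sets space_restrict_space)

lemma Delta_borel_measurable:
  "M \<in> Delta X \<Longrightarrow> borel_measurable M = borel_measurable (restrict_space borel X)"
  by (intro measurable_cong_sets) (auto simp: Delta_sets)

lemma Delta_integrable:
  fixes f :: "real \<Rightarrow> real"
  assumes "M \<in> Delta X" "f \<in> borel_measurable (restrict_space borel X)" "\<And>x. x \<in> X \<Longrightarrow> \<bar>f x\<bar> \<le> B"
  shows "integrable M f"
proof -
  interpret prob_space M using assms by (simp add: Delta_prob_space)
  show ?thesis
    using assms by (intro integrable_const_bound[of _ B])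
      (auto simp: Delta_borel_measurable Delta_space)
qed

lemma compact_continuous_bounded_measurable:
  fixes f :: "real \<Rightarrow> real"
  assumes "compact X" "continuous_on X f"
  obtains B where "0 \<le> B" "\<And>x. x \<in> X \<Longrightarrow> \<bar>f x\<bar> \<le> B" "f \<in> borel_measurable (restrict_space borel X)"
proof -
  have "bounded (f ` X)" using assms by (intro compact_imp_bounded compact_continuous_image)
  then obtain B where "\<And>x. x \<in> X \<Longrightarrow> norm (f x) \<le> B" by (auto simp: bounded_iff)
  then show thesis using assms(2)
    by (intro that[of "max 0 B"] borel_measurable_continuous_on_restrict) (auto simp: le_max_iff_disj)
qed

lemma Delta_integrable_continuous:
  fixes f :: "real \<Rightarrow> real"
  assumes "M \<in> Delta X" "compact X" "continuous_on X f"
  shows "integrable M f"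
  using compact_continuous_bounded_measurable[OF assms(2,3)] Delta_integrable[OF assms(1)] by metis

lemma return_in_Delta:
  assumes "x \<in> X" shows "return (restrict_space borel X) x \<in> Delta X"
  using assms by (auto simp: Delta_def space_restrict_space intro!: prob_space_return)

lemma integral_return_restrict:
  fixes f :: "real \<Rightarrow> real"
  assumes "x \<in> X" "f \<in> borel_measurable (restrict_space borel X)"
  shows "(\<integral>y. f y \<partial>return (restrict_space borel X) x) = f x"
  using assms by (intro integral_return) (auto simp: space_restrict_space)

text \<open>Tossing a coin with success probability a and then drawing from N or M realises the
  mixture as a monadic bind, from which its sigma-algebra, its total mass and its integrals
  follow.\<close>

lemma mix_eq_bind:
  assumes M: "M \<in> Delta X" and N: "N \<in> Delta X" and a: "0 \<le> a" "a \<le> 1"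
  shows "mix X a M N = measure_pmf (bernoulli_pmf a) \<bind> (\<lambda>b. if b then N else M)"
proof -
  let ?K = "restrict_space borel X :: real measure"
  let ?k = "\<lambda>b. if b then N else M"
  have k[measurable]: "?k \<in> measurable (measure_pmf (bernoulli_pmf a)) (subprob_algebra ?K)"
    using M N by (auto simp: space_subprob_algebra Delta_sets Delta_prob_space prob_space_imp_subprob_space)
  let ?P = "measure_pmf (bernoulli_pmf a) \<bind> ?k"
  have s: "sets ?P = sets ?K" by (rule sets_bind[of _ _ ?K]) (use M N in \<open>auto simp: Delta_sets\<close>)
  then have sp: "space ?P = X" using sets_eq_imp_space_eq[OF s] by (simp add: space_restrict_space)
  \<comment> \<open>\<open>measure_of\<close> depends only on the values of the set function on the
    generated sigma-algebra, so agreement with the measure of the bind there is enough.\<close>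
  have "mix X a M N = measure_of X (sets ?K) (emeasure ?P)"
    unfolding mix_def
  proof (rule measure_of_eq)
    show "sets ?K \<subseteq> Pow X" using sets.space_closed[of ?K] by (simp add: space_restrict_space)
    fix A assume "A \<in> sigma_sets X (sets ?K)"
    then have A: "A \<in> sets ?K"
      using sets.sigma_sets_eq[of ?K] by (simp add: space_restrict_space)
    have "emeasure ?P A = (\<integral>\<^sup>+b. emeasure (?k b) A \<partial>measure_pmf (bernoulli_pmf a))"
      by (rule emeasure_bind[OF _ k A]) simp
    also have "\<dots> = ennreal (1 - a) * emeasure M A + ennreal a * emeasure N A"
      using a by (simp add: mult.commute add.commute)
    finally show "ennreal (1 - a) * emeasure M A + ennreal a * emeasure N A = emeasure ?P A" by simp
  qed
  also have "\<dots> = ?P" using measure_of_of_measure[of ?P] by (simp add: s sp)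
  finally show ?thesis .
qed

lemma
  assumes M: "M \<in> Delta X" and N: "N \<in> Delta X" and a: "0 \<le> a" "a \<le> 1"
  shows mix_in_Delta: "mix X a M N \<in> Delta X"
    and integral_mix: "\<lbrakk>f \<in> borel_measurable (restrict_space borel X); \<And>x. x \<in> X \<Longrightarrow> \<bar>f x\<bar> \<le> B\<rbrakk>
      \<Longrightarrow> (\<integral>x. f x \<partial>mix X a M N) = (1 - a) * (\<integral>x. f x \<partial>M) + a * (\<integral>x. f x \<partial>N)"
proof -
  let ?K = "restrict_space borel X :: real measure"
  let ?k = "\<lambda>b. if b then N else M"
  have k[measurable]: "?k \<in> measurable (measure_pmf (bernoulli_pmf a)) (subprob_algebra ?K)"
    using M N by (auto simp: space_subprob_algebra Delta_sets Delta_prob_space prob_space_imp_subprob_space)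
  note eq = mix_eq_bind[OF M N a]
  have "prob_space (mix X a M N)" unfolding eq
    by (rule measure_pmf.prob_space_bind[OF _ k]) (use M N in \<open>auto simp: Delta_prob_space\<close>)
  moreover have "sets (mix X a M N) = sets ?K" unfolding eq
    by (rule sets_bind[of _ _ ?K]) (use M N in \<open>auto simp: Delta_sets\<close>)
  ultimately show "mix X a M N \<in> Delta X" by (simp add: Delta_def)
  assume f: "f \<in> borel_measurable ?K" "\<And>x. x \<in> X \<Longrightarrow> \<bar>f x\<bar> \<le> B"
  have "(\<integral>x. f x \<partial>mix X a M N) = (\<integral>b. (\<integral>x. f x \<partial>?k b) \<partial>measure_pmf (bernoulli_pmf a))"
    unfolding eq
    by (rule integral_bind[OF f(1) _ k, of B 1])
       (use M N f(2) in \<open>auto simp: space_restrict_space measure_pmf.finite_measure_axioms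
          prob_space.emeasure_space_1 Delta_prob_space\<close>)
  then show "(\<integral>x. f x \<partial>mix X a M N) = (1 - a) * (\<integral>x. f x \<partial>M) + a * (\<integral>x. f x \<partial>N)"
    using a by simp
qed

text \<open>In one direction, comparing M with a short step along a mixture and dividing by the step
  length gives the variational inequality in the limit. In the other, convexity bounds every
  difference quotient by G N - G M, so the directional derivative supports G from below and
  first-order optimality is global.\<close>

lemma maximizer_iff_linearized:
  fixes G :: "real measure \<Rightarrow> real" and f c :: "real \<Rightarrow> real"
  assumes X: "compact X" and M: "M \<in> Delta X"
    and f: "f \<in> borel_measurable (restrict_space borel X)" "\<And>x. x \<in> X \<Longrightarrow> \<bar>f x\<bar> \<le> B"
    and convex: "\<And>N a. N \<in> Delta X \<Longrightarrow> a \<in> {0..1} \<Longrightarrow> G (mix X a M N) \<le> (1 - a) * G M + a * G N"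
    and c: "continuous_on X c"
    and deriv: "\<And>N. N \<in> Delta X \<Longrightarrow>
      ((\<lambda>e. (G (mix X e M N) - G M) / e) \<longlongrightarrow> (\<integral>x. c x \<partial>N) - (\<integral>x. c x \<partial>M)) (at_right 0)"
  shows "(\<forall>N\<in>Delta X. (\<integral>x. f x \<partial>N) - G N \<le> (\<integral>x. f x \<partial>M) - G M)
    \<longleftrightarrow> (\<forall>N\<in>Delta X. (\<integral>x. f x - c x \<partial>N) \<le> (\<integral>x. f x - c x \<partial>M))"
proof -
  have split: "(\<integral>x. f x - c x \<partial>N) = (\<integral>x. f x \<partial>N) - (\<integral>x. c x \<partial>N)" if "N \<in> Delta X" for N
    using that f X c by (intro Bochner_Integration.integral_diff)
      (auto intro: Delta_integrable Delta_integrable_continuous)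
  have ev: "\<forall>\<^sub>F e in at_right 0. (e::real) \<in> {0<..<1}" by (intro eventually_at_rightI[of _ 1]) auto
  show ?thesis
  proof (intro iffI ballI)
    fix N assume max: "\<forall>N\<in>Delta X. (\<integral>x. f x \<partial>N) - G N \<le> (\<integral>x. f x \<partial>M) - G M" and N: "N \<in> Delta X"
    have "(\<integral>x. f x \<partial>N) - (\<integral>x. f x \<partial>M) \<le> (\<integral>x. c x \<partial>N) - (\<integral>x. c x \<partial>M)"
    proof (rule tendsto_lowerbound[OF deriv[OF N]])
      show "\<forall>\<^sub>F e in at_right 0. (\<integral>x. f x \<partial>N) - (\<integral>x. f x \<partial>M) \<le> (G (mix X e M N) - G M) / e"
        using ev
      proof eventually_elim
        case (elim e)
        have "(1 - e) * (\<integral>x. f x \<partial>M) + e * (\<integral>x. f x \<partial>N) - G (mix X e M N) \<le> (\<integral>x. f x \<partial>M) - G M"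
          using max mix_in_Delta[OF M N, of e] integral_mix[OF M N, of e f B] f elim by auto
        then show ?case using elim by (simp add: field_simps)
      qed
    qed simp
    then show "(\<integral>x. f x - c x \<partial>N) \<le> (\<integral>x. f x - c x \<partial>M)" using split[OF N] split[OF M] by simp
  next
    fix N assume max: "\<forall>N\<in>Delta X. (\<integral>x. f x - c x \<partial>N) \<le> (\<integral>x. f x - c x \<partial>M)" and N: "N \<in> Delta X"
    have "(\<integral>x. c x \<partial>N) - (\<integral>x. c x \<partial>M) \<le> G N - G M"
    proof (rule tendsto_upperbound[OF deriv[OF N]])
      show "\<forall>\<^sub>F e in at_right 0. (G (mix X e M N) - G M) / e \<le> G N - G M"
        using ev
      proof eventually_elim
        case (elim e)
        have "G (mix X e M N) \<le> (1 - e) * G M + e * G N" using elim by (intro convex[OF N]) auto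
        then show ?case using elim by (simp add: field_simps)
      qed
    qed simp
    then show "(\<integral>x. f x \<partial>N) - G N \<le> (\<integral>x. f x \<partial>M) - G M"
      using max split[OF N] split[OF M] N by force
  qed
qed

text \<open>Point masses turn a linear maximum into a pointwise bound by the mean of h, and a
  function bounded by its own mean equals it almost everywhere.\<close>

lemma linear_maximizer_iff_pointwise:
  fixes h :: "real \<Rightarrow> real"
  assumes M: "M \<in> Delta X"
    and h: "h \<in> borel_measurable (restrict_space borel X)" "\<And>x. x \<in> X \<Longrightarrow> \<bar>h x\<bar> \<le> B"
  shows "(\<forall>N\<in>Delta X. (\<integral>x. h x \<partial>N) \<le> (\<integral>x. h x \<partial>M))
    \<longleftrightarrow> (\<forall>x\<in>X. h x \<le> (\<integral>x. h x \<partial>M)) \<and> (AE x in M. h x = (\<integral>x. h x \<partial>M))"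
proof (intro iffI conjI ballI)
  assume max: "\<forall>N\<in>Delta X. (\<integral>x. h x \<partial>N) \<le> (\<integral>x. h x \<partial>M)"
  show le: "h x \<le> (\<integral>x. h x \<partial>M)" if "x \<in> X" for x
    using max return_in_Delta[OF that] integral_return_restrict[OF that h(1)] by metis
  interpret prob_space M using M by (rule Delta_prob_space)
  have hi: "integrable M h" using Delta_integrable[OF M h] .
  have "AE x in M. (\<integral>x. h x \<partial>M) - h x = 0"
  proof (subst integral_nonneg_eq_0_iff_AE[symmetric])
    show "AE x in M. 0 \<le> (\<integral>x. h x \<partial>M) - h x" using le by (auto simp: Delta_space[OF M])
    show "(\<integral>y. (\<integral>x. h x \<partial>M) - h y \<partial>M) = 0" using hi by (simp add: prob_space)
  qed (use hi in auto)
  then show "AE x in M. h x = (\<integral>x. h x \<partial>M)" by auto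
next
  fix N assume le: "(\<forall>x\<in>X. h x \<le> (\<integral>x. h x \<partial>M)) \<and> (AE x in M. h x = (\<integral>x. h x \<partial>M))" and N: "N \<in> Delta X"
  interpret prob_space N using N by (rule Delta_prob_space)
  have "(\<integral>x. h x \<partial>N) \<le> (\<integral>y. (\<integral>x. h x \<partial>M) \<partial>N)"
    using le Delta_integrable[OF N h] by (intro integral_mono) (auto simp: Delta_space[OF N])
  then show "(\<integral>x. h x \<partial>N) \<le> (\<integral>x. h x \<partial>M)" by (simp add: prob_space)
qed

text \<open>Pushed to the real line the measures are tight, so a subsequence converges weakly there.
  The limit lives on X since the integrals of the truncated distance to X vanish along the sequence,
  and continuous functions on X extend boundedly to the line, which carries the convergence
  back.\<close>

lemma Delta_weakly_compact:
  assumes X: "compact X" and Ms: "\<And>n. Ms n \<in> Delta X"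
  obtains r M where "strict_mono (r :: nat \<Rightarrow> nat)" "M \<in> Delta X" "weak_conv_on X (Ms \<circ> r) M"
proof -
  let ?K = "restrict_space borel X :: real measure"
  define m where "m n = distr (Ms n) borel (\<lambda>x. x)" for n
  have idm: "(\<lambda>x. x) \<in> borel_measurable (Ms n)" for n
    unfolding Delta_borel_measurable[OF Ms] by (intro measurable_restrict_space1) simp
  have rd: "real_distribution (m n)" for n
    unfolding m_def by (rule prob_space.real_distribution_distr[OF Delta_prob_space[OF Ms] idm])
  have Xne: "X \<noteq> {}" using prob_space.not_empty[OF Delta_prob_space[OF Ms[of 0]]] Delta_space[OF Ms[of 0]] by simp
  have Xcl: "closed X" using X by (rule compact_imp_closed)
  obtain b where b: "\<And>x. x \<in> X \<Longrightarrow> \<bar>x\<bar> \<le> b"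
    using compact_imp_bounded[OF X] by (auto simp: bounded_iff)
  have b0: "0 \<le> b" using b Xne by fastforce
  \<comment> \<open>The left end is -b - 1 because the interval is open there and -b may belong to
    X.\<close>
  have m1: "measure (m n) {- b - 1<..b} = 1" for n
  proof -
    have "measure (m n) {- b - 1<..b} = measure (Ms n) ((\<lambda>x. x) -` {- b - 1<..b} \<inter> space (Ms n))"
      unfolding m_def by (rule measure_distr[OF idm]) simp
    also have "(\<lambda>x. x) -` {- b - 1<..b} \<inter> space (Ms n) = space (Ms n)"
      using b by (force simp: Delta_space[OF Ms])
    finally show ?thesis using prob_space.prob_space[OF Delta_prob_space[OF Ms]] by simp
  qed
  have "tight m" unfolding tight_def
    using rd m1 b0 by (intro conjI allI impI exI[of _ "- b - 1"] exI[of _ b]) auto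
  from tight_imp_convergent_subsubsequence[OF this strict_mono_id]
  obtain r P where r: "strict_mono r" and P: "real_distribution P" and wc: "weak_conv_m (\<lambda>n. m (r n)) P"
    by (auto simp: comp_def)
  interpret P: real_distribution P by fact
  have conv: "(\<lambda>n. \<integral>x. g x \<partial>m (r n)) \<longlonglongrightarrow> (\<integral>x. g x \<partial>P)"
    if "continuous_on UNIV g" "\<And>x. \<bar>g x\<bar> \<le> B" for g :: "real \<Rightarrow> real" and B
    using that by (intro weak_conv_imp_integral_bdd_continuous_conv[OF rd P wc, of g B])
      (auto simp: continuous_on_eq_continuous_at)
  have int_m: "(\<integral>x. g x \<partial>m n) = (\<integral>x. g x \<partial>Ms n)" if "continuous_on UNIV g" for g :: "real \<Rightarrow> real" and n
    unfolding m_def by (rule integral_distr[OF idm]) (use that in \<open>simp add: borel_measurable_continuous_onI\<close>)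
  have AEX: "AE x in P. x \<in> X"
  proof -
    \<comment> \<open>Truncated distance: bounded, continuous, and zero exactly on the closed set
      X.\<close>
    let ?g = "\<lambda>x. min 1 (infdist x X)"
    have gc: "continuous_on UNIV ?g" by (intro continuous_intros)
    have gm[measurable]: "?g \<in> borel_measurable borel" using gc by (rule borel_measurable_continuous_onI)
    have "(\<integral>x. ?g x \<partial>m n) = 0" for n
    proof -
      have "(\<integral>x. ?g x \<partial>m n) = (\<integral>x. ?g x \<partial>Ms n)" using int_m[OF gc] .
      also have "\<dots> = (\<integral>x. 0 \<partial>Ms n)"
        by (rule Bochner_Integration.integral_cong) (auto simp: Delta_space[OF Ms])
      finally show ?thesis by simp
    qed
    then have "(\<integral>x. ?g x \<partial>P) = 0"
      using conv[OF gc, of 1] by (simp add: infdist_nonneg LIMSEQ_const_iff)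
    then have "AE x in P. ?g x = 0"
      by (subst (asm) integral_nonneg_eq_0_iff_AE)
         (auto simp: infdist_nonneg intro!: P.integrable_const_bound[of _ 1])
    then show ?thesis
      by eventually_elim (use Xcl Xne in \<open>auto simp: min_def in_closed_iff_infdist_zero split: if_splits\<close>)
  qed
  have Xb[measurable]: "X \<in> sets borel" using Xcl by simp
  define M where "M = restrict_space P X"
  have PX: "emeasure P X = 1" using AEX by (intro P.emeasure_eq_1_AE) auto
  have MD: "M \<in> Delta X"
    unfolding Delta_def M_def using PX
    by (auto intro!: prob_space_restrict_space simp: sets_restrict_space)
  have "weak_conv_on X (Ms \<circ> r) M"
    unfolding weak_conv_on_def comp_def
  proof (intro allI impI)
    fix f :: "real \<Rightarrow> real" assume f: "continuous_on X f"
    obtain B where B: "0 \<le> B" "\<And>x. x \<in> X \<Longrightarrow> \<bar>f x\<bar> \<le> B"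
      using compact_continuous_bounded_measurable[OF X f] by metis
    obtain g where g: "continuous_on UNIV g" "\<And>x. x \<in> X \<Longrightarrow> g x = f x" "\<And>x. \<bar>g x\<bar> \<le> B"
      using Tietze[OF f, of UNIV B] B Xcl by auto
    have gm[measurable]: "g \<in> borel_measurable borel" using g(1) by (rule borel_measurable_continuous_onI)
    have "(\<integral>x. f x \<partial>Ms n) = (\<integral>x. g x \<partial>m n)" for n
      unfolding int_m[OF g(1)] by (rule Bochner_Integration.integral_cong) (auto simp: Delta_space[OF Ms] g)
    moreover have "(\<integral>x. f x \<partial>M) = (\<integral>x. g x \<partial>P)"
    proof -
      have "(\<integral>x. f x \<partial>M) = (\<integral>x. g x \<partial>M)"
        by (rule Bochner_Integration.integral_cong) (auto simp: Delta_space[OF MD] g)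
      also have "\<dots> = (\<integral>x. indicator X x *\<^sub>R g x \<partial>P)"
        unfolding M_def by (rule integral_restrict_space) simp
      also have "\<dots> = (\<integral>x. g x \<partial>P)"
        using AEX by (intro integral_cong_AE) auto
      finally show ?thesis .
    qed
    ultimately show "(\<lambda>n. \<integral>x. f x \<partial>Ms (r n)) \<longlonglongrightarrow> (\<integral>x. f x \<partial>M)"
      using conv[OF g(1,3)] by simp
  qed
  with r MD show thesis by (rule that)
qed

lemma weak_conv_integral_usc:
  fixes f :: "real \<Rightarrow> real"
  assumes X: "compact X" and Ms: "\<And>n. Ms n \<in> Delta X" and M: "M \<in> Delta X"
    and conv: "weak_conv_on X Ms M"
    and f: "f \<in> borel_measurable (restrict_space borel X)" "\<And>x. x \<in> X \<Longrightarrow> \<bar>f x\<bar> \<le> B"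
    and usc: "\<And>x e. x \<in> X \<Longrightarrow> 0 < e \<Longrightarrow> \<exists>d>0. \<forall>y\<in>X. \<bar>y - x\<bar> < d \<longrightarrow> f y < f x + e"
    and e: "0 < e"
  shows "\<forall>\<^sub>F n in sequentially. (\<integral>x. f x \<partial>Ms n) < (\<integral>x. f x \<partial>M) + e"
proof -
  \<comment> \<open>Lipschitz approximations decreasing to \<open>f\<close>; their convergence is where semicontinuity enters.\<close>
  define g where "g k x = (SUP y\<in>X. f y - real k * \<bar>x - y\<bar>)" for k :: nat and x
  have bdd: "bdd_above ((\<lambda>y. f y - real k * \<bar>x - y\<bar>) ` X)" for k x
  proof (rule bdd_aboveI2)
    fix y assume "y \<in> X"
    then have "f y \<le> B" using f(2) by fastforce
    moreover have "0 \<le> real k * \<bar>x - y\<bar>" by simp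
    ultimately show "f y - real k * \<bar>x - y\<bar> \<le> B" by linarith
  qed
  have Xne: "X \<noteq> {}" using prob_space.not_empty[OF Delta_prob_space[OF M]] Delta_space[OF M] by simp
  have fg: "f x \<le> g k x" if "x \<in> X" for k x
    unfolding g_def using cSUP_upper[OF that bdd, of k x] by simp
  have gB: "g k x \<le> B" for k x unfolding g_def
  proof (rule cSUP_least[OF Xne])
    fix y assume "y \<in> X"
    then have "f y \<le> B" using f(2) by fastforce
    moreover have "0 \<le> real k * \<bar>x - y\<bar>" by simp
    ultimately show "f y - real k * \<bar>x - y\<bar> \<le> B" by linarith
  qed
  have glip: "g k x \<le> g k x' + real k * \<bar>x - x'\<bar>" for k x x'
    unfolding g_def
  proof (rule cSUP_least[OF Xne])
    fix y assume y: "y \<in> X"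
    have "real k * \<bar>x' - y\<bar> \<le> real k * \<bar>x - y\<bar> + real k * \<bar>x - x'\<bar>"
      unfolding distrib_left[symmetric] by (intro mult_left_mono) auto
    then show "f y - real k * \<bar>x - y\<bar> \<le> (SUP y\<in>X. f y - real k * \<bar>x' - y\<bar>) + real k * \<bar>x - x'\<bar>"
      using cSUP_upper[OF y bdd, of k x'] by linarith
  qed
  have gc: "continuous_on X (g k)" for k
  proof (rule lipschitz_on_continuous_on[of "real k"], rule lipschitz_onI)
    show "dist (g k x) (g k y) \<le> real k * dist x y" for x y
      using glip[of k x y] glip[of k y x] by (auto simp: dist_real_def abs_le_iff abs_minus_commute)
  qed simp
  have glim: "(\<lambda>k. g k x) \<longlonglongrightarrow> f x" if x: "x \<in> X" for x
  proof (rule LIMSEQ_I)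
    fix e :: real assume "0 < e"
    then have e2: "0 < e / 2" by simp
    obtain d where d: "d > 0" "\<And>y. y \<in> X \<Longrightarrow> \<bar>y - x\<bar> < d \<Longrightarrow> f y < f x + e / 2"
      using usc[OF x e2] by blast
    \<comment> \<open>Beyond distance d the penalty is at least 2B, which bounds the oscillation of
      f, so only points near x can push the supremum above f x.\<close>
    obtain m where m: "2 * B / d < real m" using reals_Archimedean2 by blast
    have "norm (g k x - f x) < e" if "k \<ge> m" for k
    proof -
      have kd: "2 * B \<le> real k * d" using m that d(1)
        by (simp add: field_simps) (smt (verit) mult_right_mono of_nat_le_iff mult.commute)
      have "g k x \<le> f x + e / 2"
        unfolding g_def
      proof (rule cSUP_least[OF Xne])
        fix y assume y: "y \<in> X"
        show "f y - real k * \<bar>x - y\<bar> \<le> f x + e / 2"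
        proof (cases "\<bar>y - x\<bar> < d")
          case True
          moreover have "0 \<le> real k * \<bar>x - y\<bar>" by simp
          ultimately show ?thesis using d(2)[OF y] by linarith
        next
          case False
          then have "real k * d \<le> real k * \<bar>x - y\<bar>" by (intro mult_left_mono) auto
          then show ?thesis using kd f(2)[OF y] f(2)[OF x] e2 by linarith
        qed
      qed
      then show ?thesis using fg[OF x, of k] \<open>0 < e\<close> by simp
    qed
    then show "\<exists>m. \<forall>k\<ge>m. norm (g k x - f x) < e" by blast
  qed
  have fi: "integrable N f" if "N \<in> Delta X" for N using Delta_integrable[OF that f] .
  have gi: "integrable N (g k)" if "N \<in> Delta X" for N k using Delta_integrable_continuous[OF that X gc] .
  interpret M: prob_space M using M by (rule Delta_prob_space)
  have "(\<lambda>k. \<integral>x. g k x \<partial>M) \<longlonglongrightarrow> (\<integral>x. f x \<partial>M)"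
  proof (rule integral_dominated_convergence[where w="\<lambda>_. B"])
    show "AE x in M. (\<lambda>k. g k x) \<longlonglongrightarrow> f x" using glim by (auto simp: Delta_space[OF M])
    show "AE x in M. norm (g k x) \<le> B" for k
      using gB[of k] fg[of _ k] f(2) by (fastforce simp: Delta_space[OF M] abs_le_iff intro!: AE_I2)
  qed (use fi[OF M] gi[OF M] in auto)
  then have "\<forall>\<^sub>F k in sequentially. (\<integral>x. g k x \<partial>M) < (\<integral>x. f x \<partial>M) + e"
    using e by (intro order_tendstoD(2)) auto
  then obtain k where k: "(\<integral>x. g k x \<partial>M) < (\<integral>x. f x \<partial>M) + e" by (auto simp: eventually_sequentially)
  \<comment> \<open>With k fixed, \<open>g k\<close> is continuous and weak convergence applies; f
    \<le> \<open>g k\<close> on X then passes the bound to f.\<close>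
  have "(\<lambda>n. \<integral>x. g k x \<partial>Ms n) \<longlonglongrightarrow> (\<integral>x. g k x \<partial>M)" using conv gc unfolding weak_conv_on_def by blast
  then have "\<forall>\<^sub>F n in sequentially. (\<integral>x. g k x \<partial>Ms n) < (\<integral>x. f x \<partial>M) + e"
    using k by (rule order_tendstoD(2))
  then show ?thesis
  proof eventually_elim
    case (elim n)
    have "(\<integral>x. f x \<partial>Ms n) \<le> (\<integral>x. g k x \<partial>Ms n)"
      using fg by (intro integral_mono fi gi Ms) (auto simp: Delta_space[OF Ms])
    with elim show ?case by simp
  qed
qed

text \<open>Direct method: a maximizing sequence has a weakly convergent subsequence, and its limit
  is optimal because integrals of an upper semicontinuous f can only jump up in the limit while G is
  continuous.\<close>

lemma exists_maximizer:
  fixes G :: "real measure \<Rightarrow> real" and f :: "real \<Rightarrow> real"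
  assumes X: "compact X" "X \<noteq> {}"
    and f: "f \<in> borel_measurable (restrict_space borel X)" "\<And>x. x \<in> X \<Longrightarrow> \<bar>f x\<bar> \<le> B"
    and usc: "\<And>x e. x \<in> X \<Longrightarrow> 0 < e \<Longrightarrow> \<exists>d>0. \<forall>y\<in>X. \<bar>y - x\<bar> < d \<longrightarrow> f y < f x + e"
    and G: "\<And>Ms M. \<lbrakk>\<And>n. Ms n \<in> Delta X; M \<in> Delta X; weak_conv_on X Ms M\<rbrakk> \<Longrightarrow> (\<lambda>n. G (Ms n)) \<longlonglongrightarrow> G M"
    and G_bdd: "\<And>M. M \<in> Delta X \<Longrightarrow> \<bar>G M\<bar> \<le> BG"
  shows "\<exists>M\<in>Delta X. \<forall>N\<in>Delta X. (\<integral>x. f x \<partial>N) - G N \<le> (\<integral>x. f x \<partial>M) - G M"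
proof -
  define v where "v N = (\<integral>x. f x \<partial>N) - G N" for N
  have Dne: "Delta X \<noteq> {}" using return_in_Delta X(2) by blast
  have "v N \<le> B + BG" if N: "N \<in> Delta X" for N
  proof -
    interpret prob_space N using N by (rule Delta_prob_space)
    have "(\<integral>x. f x \<partial>N) \<le> (\<integral>x. B \<partial>N)"
      using Delta_integrable[OF N f] f(2) by (intro integral_mono) (fastforce simp: Delta_space[OF N])+
    then show ?thesis using G_bdd[OF N] by (simp add: v_def prob_space)
  qed
  then have bdd: "bdd_above (v ` Delta X)" by (rule bdd_aboveI2)
  define S where "S = (SUP N\<in>Delta X. v N)"
  have vS: "v N \<le> S" if "N \<in> Delta X" for N unfolding S_def using that bdd by (rule cSUP_upper)
  have "\<exists>N. N \<in> Delta X \<and> S - inverse (real (Suc n)) < v N" for n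
    using less_cSUP_iff[OF Dne bdd, of "S - inverse (real (Suc n))"] by (auto simp: S_def)
  then have "\<exists>Ns. \<forall>n. Ns n \<in> Delta X \<and> S - inverse (real (Suc n)) < v (Ns n)" by (intro choice allI)
  then obtain Ns where Ns: "\<And>n. Ns n \<in> Delta X" "\<And>n. S - inverse (real (Suc n)) < v (Ns n)" by blast
  obtain r M where r: "strict_mono r" and M: "M \<in> Delta X" and wc: "weak_conv_on X (Ns \<circ> r) M"
    by (rule Delta_weakly_compact[OF X(1) Ns(1)])
  have Nr: "(Ns \<circ> r) n \<in> Delta X" for n using Ns by simp
  have "S \<le> v M"
  \<comment> \<open>One third of e each goes to the gap along the maximizing sequence, to
    semicontinuity, and to the convergence of G.\<close>
  proof (rule field_le_epsilon)
    fix e :: real assume e: "0 < e"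
    have "(\<lambda>n. inverse (real (Suc n))) \<longlonglongrightarrow> 0" by (rule LIMSEQ_inverse_real_of_nat)
    from LIMSEQ_subseq_LIMSEQ[OF this r]
    have "\<forall>\<^sub>F n in sequentially. inverse (real (Suc (r n))) < e / 3"
      using e by (intro order_tendstoD(2)) (auto simp: comp_def)
    moreover have "\<forall>\<^sub>F n in sequentially. (\<integral>x. f x \<partial>(Ns \<circ> r) n) < (\<integral>x. f x \<partial>M) + e / 3"
      using e by (intro weak_conv_integral_usc[OF X(1) Nr M wc f usc]) auto
    moreover have "\<forall>\<^sub>F n in sequentially. G M - e / 3 < G ((Ns \<circ> r) n)"
      using e by (intro order_tendstoD(1)[OF G[OF Nr M wc]]) auto
    ultimately have "\<forall>\<^sub>F n in sequentially. S \<le> v M + e"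
    proof eventually_elim
      case (elim n)
      then show ?case using Ns(2)[of "r n"] by (simp add: v_def)
    qed
    then show "S \<le> v M + e" by simp
  qed
  then have "\<forall>N\<in>Delta X. v N \<le> v M" using vS by (auto intro: order_trans)
  then show ?thesis using M unfolding v_def by blast
qed

text \<open>To the right of x continuity bounds the rise, and to the left monotonicity allows none;
  a jump of f at x only lowers the values on its left.\<close>

lemma mono_right_continuous_usc:
  fixes f :: "real \<Rightarrow> real"
  assumes mono: "mono_on X f" and rc: "continuous (at x within ({x..} \<inter> X)) f" and x: "x \<in> X" and e: "0 < e"
  shows "\<exists>d>0. \<forall>y\<in>X. \<bar>y - x\<bar> < d \<longrightarrow> f y < f x + e"
proof -
  obtain d where d: "d > 0" "\<And>y. y \<in> {x..} \<inter> X \<Longrightarrow> dist y x < d \<Longrightarrow> dist (f y) (f x) < e"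
    using rc e unfolding continuous_within_eps_delta by blast
  have "f y < f x + e" if y: "y \<in> X" "\<bar>y - x\<bar> < d" for y
  proof (cases "x \<le> y")
    case True
    then have "dist (f y) (f x) < e" using y by (intro d(2)) (auto simp: dist_real_def)
    then show ?thesis unfolding dist_real_def by linarith
  next
    case False
    then have "f y \<le> f x" using mono x y(1) by (intro mono_onD[OF mono]) auto
    then show ?thesis using e by linarith
  qed
  with d(1) show ?thesis by blast
qed

lemma mono_on_compact_bounded:
  fixes f :: "real \<Rightarrow> real"
  assumes "compact X" "X \<noteq> {}" "mono_on X f"
  obtains B where "\<And>x. x \<in> X \<Longrightarrow> \<bar>f x\<bar> \<le> B"
proof -
  obtain a b where a: "a \<in> X" "\<And>x. x \<in> X \<Longrightarrow> a \<le> x" and b: "b \<in> X" "\<And>x. x \<in> X \<Longrightarrow> x \<le> b"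
    using compact_attains_inf[OF assms(1,2)] compact_attains_sup[OF assms(1,2)] by metis
  have "\<bar>f x\<bar> \<le> max \<bar>f a\<bar> \<bar>f b\<bar>" if "x \<in> X" for x
    using mono_onD[OF assms(3) a(1) that a(2)[OF that]] mono_onD[OF assms(3) that b(1) b(2)[OF that]]
    by linarith
  then show thesis by (rule that)
qed

section \<open>Envelope formula\<close>

text \<open>The hypothesis \<open>ineq\<close> bounds the left difference quotients of \<open>W\<close>
  at \<open>t\<close> by those of \<open>D t\<close>, which is enough for Lusin's condition, and it squeezes \<open>- g t\<close> between
  the left and the right derivative of \<open>W\<close>.\<close>
lemma envelope_abs_cont_has_integral:
  fixes W :: "real \<Rightarrow> real" and D :: "real \<Rightarrow> real \<Rightarrow> real"
  assumes lohi: "lo < hi"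
    and ineq: "\<And>s t. \<lbrakk>s \<in> {lo..hi}; t \<in> {lo..hi}\<rbrakk> \<Longrightarrow> W t - W s \<le> D t s - D t t"
    and anti: "\<And>t x y. \<lbrakk>t \<in> {lo..hi}; lo \<le> x; x \<le> y; y \<le> hi\<rbrakk> \<Longrightarrow> D t y \<le> D t x"
    and diff: "\<And>t. t \<in> {lo..hi} \<Longrightarrow> (D t has_real_derivative g t) (at t within {lo..hi})"
    and cont: "continuous_on {lo..hi} W"
  shows "abs_cont_on lo hi W"
    and "\<And>a b. \<lbrakk>lo \<le> a; a \<le> b; b \<le> hi\<rbrakk> \<Longrightarrow> (g has_integral (W a - W b)) {a..b}"
proof -
  \<comment> \<open>\<open>p\<close> clamps to [lo, hi] and F continues W outside by lines of slope
    one, which makes F surjective as well as monotone and continuous on the whole line.\<close>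
  define p where "p x = max lo (min hi x)" for x
  define F where "F x = W (p x) + (x - p x)" for x
  have pI: "p x \<in> {lo..hi}" for x using lohi by (auto simp: p_def)
  have pid: "p x = x" if "x \<in> {lo..hi}" for x using that by (auto simp: p_def)
  have FW: "F x = W x" if "x \<in> {lo..hi}" for x using that by (simp add: F_def pid)
  have Flo: "F x = W lo + (x - lo)" if "x \<le> lo" for x
    using that lohi by (simp add: F_def p_def)
  have Fhi: "F x = W hi + (x - hi)" if "x \<ge> hi" for x
    using that lohi by (simp add: F_def p_def)
  \<comment> \<open>Exchanging the roles of the two types: W s - W t \<le> D s t - D s s \<le>
    0.\<close>
  have Wmono: "W s \<le> W t" if "lo \<le> s" "s \<le> t" "t \<le> hi" for s t
    using ineq[of t s] anti[of s s t] that by simp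
  have Fmono: "F x \<le> F y" if "x \<le> y" for x y
    unfolding F_def using Wmono[of "p x" "p y"] pI[of x] pI[of y] that
    by (auto simp: p_def max_def min_def split: if_splits)
  have pc: "continuous_on UNIV p" unfolding p_def by (intro continuous_intros)
  have Fcont: "continuous_on UNIV F" unfolding F_def
    by (intro continuous_intros continuous_on_compose2[OF cont pc] pc) (use pI in auto)
  have Fsurj: "surj F"
  proof -
    have "\<exists>x. F x = y" for y
    proof -
      consider "y \<le> W lo" | "W lo \<le> y" "y \<le> W hi" | "W hi \<le> y" by linarith
      then show ?thesis
      proof cases
        case 1 then show ?thesis by (intro exI[of _ "lo + (y - W lo)"]) (simp add: Flo)
      next
        case 2 then show ?thesis using IVT'[of W lo y hi] lohi cont FW by force
      next
        case 3 then show ?thesis by (intro exI[of _ "hi + (y - W hi)"]) (simp add: Fhi)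
      qed
    qed
    then show ?thesis by (metis surjI)
  qed
  have left: "\<exists>L d. 0 < d \<and> (\<forall>t. x - d < t \<and> t \<le> x \<longrightarrow> F x - F t \<le> L * (x - t))" if "x \<noteq> lo" for x
  proof -
    consider "x < lo" | "lo < x" "x \<le> hi" | "hi < x" using \<open>x \<noteq> lo\<close> by linarith
    then show ?thesis
    proof cases
      case 1 then show ?thesis by (intro exI[of _ 1]) (auto simp: Flo)
    next
      case 3 then show ?thesis by (intro exI[of _ 1] exI[of _ "x - hi"]) (auto simp: Fhi)
    next
      case 2
      then have x: "x \<in> {lo..hi}" by simp
      \<comment> \<open>Differentiability with tolerance 1 gives the slope 1 - g x; the radius used
        afterwards is cut to x - lo to remain in the domain.\<close>
      obtain d where d: "0 < d" "\<And>t. t \<in> {lo..hi} \<Longrightarrow> norm (t - x) < d \<Longrightarrow>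
          norm (D x t - D x x - g x * (t - x)) \<le> 1 * norm (t - x)"
        using diff[OF x] unfolding has_field_derivative_def has_derivative_within_alt
        by (metis zero_less_one)
      have "F x - F t \<le> (1 - g x) * (x - t)" if "x - min d (x - lo) < t" "t \<le> x" for t
      proof -
        have t: "t \<in> {lo..hi}" "norm (t - x) < d" using that 2 by auto
        have "F x - F t \<le> D x t - D x x" using FW x t ineq by simp
        also have "\<dots> \<le> (1 - g x) * (x - t)"
          using d(2)[OF t] that by (auto simp: algebra_simps abs_le_iff)
        finally show ?thesis .
      qed
      then show ?thesis using d(1) 2 by (intro exI[of _ "1 - g x"] exI[of _ "min d (x - lo)"]) auto
    qed
  qed
  have "absolutely_continuous lborel (interval_measure F)"
    by (rule absolutely_continuous_interval_measure[OF Fmono Fcont Fsurj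
          negligible_image_left_Lipschitz[OF Fmono left]])
  from interval_measure_density[OF Fmono Fcont this] obtain f where
    fm: "f \<in> borel_measurable borel" and f0: "\<And>x. 0 \<le> f x"
    and fi: "\<And>a b. a \<le> b \<Longrightarrow> set_integrable lborel {a..b} f"
    and fL: "\<And>a b. a \<le> b \<Longrightarrow> (LINT x:{a<..b}|lborel. f x) = F b - F a"
    and fH: "\<And>a b. a \<le> b \<Longrightarrow> (f has_integral (F b - F a)) {a..b}" by blast
  show "abs_cont_on lo hi W"
    by (rule abs_cont_on_indefinite_integral[OF fm f0 fi]) (use lohi fL FW in auto)
  obtain N1 where N1: "negligible N1"
    "\<And>x. x \<notin> N1 \<Longrightarrow> ((\<lambda>h. (F (x + h) - F x) / h) \<longlongrightarrow> f x) (at_right 0)"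
    using right_derivative_integral_ae[OF fH] by blast
  obtain N2 where N2: "negligible N2"
    "\<And>x. x \<notin> N2 \<Longrightarrow> ((\<lambda>h. (F x - F (x - h)) / h) \<longlongrightarrow> f x) (at_right 0)"
    using left_derivative_integral_ae[OF fH] by blast
  have fg: "f x = - g x" if x: "x \<in> {lo<..<hi}" "x \<notin> N1" "x \<notin> N2" for x
  proof (rule antisym)
    have "(D x has_real_derivative g x) (at x)"
      using diff[of x] x at_within_interior[of x "{lo..hi}"] by simp
    then have Dx: "((\<lambda>h. (D x (x + h) - D x x) / h) \<longlongrightarrow> g x) (at 0)" by (simp add: DERIV_def)
    define d where "d = min (x - lo) (hi - x)"
    have d: "d > 0" using x by (simp add: d_def)
    have ev: "\<forall>\<^sub>F h in at_right 0. h \<in> {0<..<d}"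
      using d by (intro eventually_at_rightI[of _ d]) auto
    have R: "((\<lambda>h. - ((D x (x + h) - D x x) / h)) \<longlongrightarrow> - g x) (at_right 0)"
      using Dx by (intro tendsto_minus) (auto intro: filterlim_mono at_le)
    \<comment> \<open>The two-sided derivative read along -h yields the left quotients.\<close>
    have "((\<lambda>h. (D x (x + - h) - D x x) / - h) \<longlongrightarrow> g x) (at_right 0)"
    proof (rule filterlim_compose[OF Dx])
      have "((\<lambda>h::real. - h) \<longlongrightarrow> - 0) (at_right 0)" by (intro tendsto_intros)
      then show "filterlim (\<lambda>h::real. - h) (at 0) (at_right 0)"
        by (simp add: filterlim_at eventually_at_filter)
    qed
    from tendsto_minus[OF this]
    have L: "((\<lambda>h. (D x (x - h) - D x x) / h) \<longlongrightarrow> - g x) (at_right 0)" by simp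
    show "- g x \<le> f x"
    proof (rule tendsto_le[OF _ N1(2)[OF x(2)] R])
      show "\<forall>\<^sub>F h in at_right 0. - ((D x (x + h) - D x x) / h) \<le> (F (x + h) - F x) / h"
        using ev
      proof eventually_elim
        case (elim h)
        then have "x + h \<in> {lo..hi}" "x \<in> {lo..hi}" "0 < h" using x by (auto simp: d_def)
        then show ?case using ineq[of "x + h" x] FW
          by (simp add: minus_divide_left divide_right_mono)
      qed
    qed simp
    show "f x \<le> - g x"
    proof (rule tendsto_le[OF _ L N2(2)[OF x(3)]])
      show "\<forall>\<^sub>F h in at_right 0. (F x - F (x - h)) / h \<le> (D x (x - h) - D x x) / h"
        using ev
      proof eventually_elim
        case (elim h)
        then have "x - h \<in> {lo..hi}" "x \<in> {lo..hi}" "0 < h" using x by (auto simp: d_def)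
        then show ?case using ineq[of "x - h" x] FW by (simp add: divide_right_mono)
      qed
    qed simp
  qed
  fix a b assume ab: "lo \<le> a" "a \<le> b" "b \<le> hi"
  \<comment> \<open>At lo and hi the comparison of one-sided limits lacks room on one side, so both
    points join the null set.\<close>
  have neg: "negligible (N1 \<union> N2 \<union> {lo, hi})" using N1(1) N2(1) by (intro negligible_Un) auto
  have "((\<lambda>x. - f x) has_integral - (F b - F a)) {a..b}" using fH[OF ab(2)] by (rule has_integral_neg)
  then have "(g has_integral - (F b - F a)) {a..b}"
    by (rule has_integral_spike[OF neg, rotated]) (use fg ab in force)
  then show "(g has_integral (W a - W b)) {a..b}" using FW ab by simp
qed

text \<open>To the left of t the bound involves the single measure \<open>N t\<close>, so continuity
  of C in its type suffices. To the right the measure moves with the type, which calls for a weak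
  limit. Monotonicity of W joins the two estimates.\<close>

lemma envelope_continuous:
  fixes C :: "real \<Rightarrow> real measure \<Rightarrow> real" and W :: "real \<Rightarrow> real" and N :: "real \<Rightarrow> real measure"
  assumes X: "compact X"
    and N: "\<And>t. t \<in> {lo..hi} \<Longrightarrow> N t \<in> Delta X"
    and ineq: "\<And>s t. \<lbrakk>s \<in> {lo..hi}; t \<in> {lo..hi}\<rbrakk> \<Longrightarrow> W t - W s \<le> C s (N t) - C t (N t)"
    and anti: "\<And>M x y. \<lbrakk>M \<in> Delta X; lo \<le> x; x \<le> y; y \<le> hi\<rbrakk> \<Longrightarrow> C y M \<le> C x M"
    and C_cont: "\<And>M. M \<in> Delta X \<Longrightarrow> continuous_on {lo..hi} (\<lambda>t. C t M)"
    and C_weak: "\<And>t Ms M. \<lbrakk>t \<in> {lo..hi}; \<And>n. Ms n \<in> Delta X; M \<in> Delta X; weak_conv_on X Ms M\<rbrakk>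
      \<Longrightarrow> (\<lambda>n. C t (Ms n)) \<longlonglongrightarrow> C t M"
  shows "continuous_on {lo..hi} W"
proof -
  have mono: "W s \<le> W t" if "lo \<le> s" "s \<le> t" "t \<le> hi" for s t
    using ineq[of t s] anti[OF N, of s s t] that by simp
  have left: "\<exists>d>0. \<forall>s\<in>{lo..hi}. s \<le> t \<and> t - s < d \<longrightarrow> W t - W s < e"
    if t: "t \<in> {lo..hi}" and e: "0 < e" for t e
  proof -
    obtain d where d: "d > 0" "\<And>s. s \<in> {lo..hi} \<Longrightarrow> dist s t < d \<Longrightarrow> dist (C s (N t)) (C t (N t)) < e"
      using C_cont[OF N[OF t]] t e unfolding continuous_on_iff by blast
    have "W t - W s < e" if "s \<in> {lo..hi}" "s \<le> t" "t - s < d" for s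
      using ineq[OF that(1) t] d(2)[OF that(1)] that by (auto simp: dist_real_def)
    then show ?thesis using d(1) by blast
  qed
  have right: "\<exists>d>0. \<forall>s\<in>{lo..hi}. t \<le> s \<and> s - t < d \<longrightarrow> W s - W t < e"
    if t: "t \<in> {lo..hi}" and e: "0 < e" for t e
  proof (rule ccontr)
    \<comment> \<open>A jump at \<open>t\<close> would survive in the weak limit of the measures chosen just to the right of \<open>t\<close>,
      against the continuity of \<open>C\<close> in its first argument at that limit.\<close>
    assume neg: "\<not> ?thesis"
    have "\<exists>s\<in>{lo..hi}. t \<le> s \<and> s - t < inverse (real (Suc n)) \<and> e \<le> W s - W t" for n
    proof -
      have "0 < inverse (real (Suc n))" by simp
      with neg show ?thesis by (meson not_less)
    qed
    then obtain s where s: "\<And>n. s n \<in> {lo..hi}" "\<And>n. t \<le> s n" "\<And>n. s n - t < inverse (real (Suc n))"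
      "\<And>n. e \<le> W (s n) - W t" by metis
    obtain r M where r: "strict_mono r" and M: "M \<in> Delta X" and wc: "weak_conv_on X ((\<lambda>n. N (s n)) \<circ> r) M"
      using Delta_weakly_compact[OF X, of "\<lambda>n. N (s n)"] N s(1) by blast
    have Nr: "((\<lambda>n. N (s n)) \<circ> r) n \<in> Delta X" for n using N s(1) by simp
    obtain d where d: "d > 0" "\<And>x. x \<in> {lo..hi} \<Longrightarrow> dist x t < d \<Longrightarrow> dist (C x M) (C t M) < e / 2"
      using C_cont[OF M] t e unfolding continuous_on_iff by (metis half_gt_zero)
    \<comment> \<open>Once s (r n) lies below x, replacing it by the fixed x only enlarges the cost
      gap, and at fixed types the gap passes to the weak limit.\<close>
    have le: "e \<le> C t M - C x M" if x: "x \<in> {lo..hi}" "t < x" for x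
    proof (rule tendsto_lowerbound)
      show "(\<lambda>n. C t (((\<lambda>n. N (s n)) \<circ> r) n) - C x (((\<lambda>n. N (s n)) \<circ> r) n)) \<longlonglongrightarrow> C t M - C x M"
        using t x by (intro tendsto_diff C_weak Nr M wc) auto
      have "\<forall>\<^sub>F n in sequentially. inverse (real (Suc (r n))) < x - t"
        using x LIMSEQ_subseq_LIMSEQ[OF LIMSEQ_inverse_real_of_nat r]
        by (intro order_tendstoD(2)) (auto simp: comp_def)
      then show "\<forall>\<^sub>F n in sequentially. e \<le> C t (((\<lambda>n. N (s n)) \<circ> r) n) - C x (((\<lambda>n. N (s n)) \<circ> r) n)"
      proof eventually_elim
        case (elim n)
        have "C x (N (s (r n))) \<le> C (s (r n)) (N (s (r n)))"
          using elim s(1,3)[of "r n"] x by (intro anti N s(1)) auto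
        then show ?case using ineq[OF t s(1), of "r n"] s(4)[of "r n"] by simp
      qed
    qed simp
    \<comment> \<open>A point s 0 strictly to the right of t guarantees room in the interval for a
      type within d of t.\<close>
    have "t < s 0" using s(2,4)[of 0] e by (cases "t = s 0") auto
    then have "t < min (s 0) (t + d / 2)" "min (s 0) (t + d / 2) \<in> {lo..hi}"
      using d(1) s(1)[of 0] t by auto
    moreover from this have "dist (min (s 0) (t + d / 2)) t < d" using d(1) by (auto simp: dist_real_def)
    ultimately have "e \<le> C t M - C (min (s 0) (t + d / 2)) M"
      "dist (C (min (s 0) (t + d / 2)) M) (C t M) < e / 2" using le d(2) by blast+
    then show False using e unfolding dist_real_def by linarith
  qed
  show ?thesis unfolding continuous_on_iff
  proof (intro ballI allI impI)
    fix t e :: real assume t: "t \<in> {lo..hi}" and e: "0 < e"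
    obtain d1 where d1: "d1 > 0" "\<And>s. s \<in> {lo..hi} \<Longrightarrow> s \<le> t \<Longrightarrow> t - s < d1 \<Longrightarrow> W t - W s < e"
      using left[OF t e] by blast
    obtain d2 where d2: "d2 > 0" "\<And>s. s \<in> {lo..hi} \<Longrightarrow> t \<le> s \<Longrightarrow> s - t < d2 \<Longrightarrow> W s - W t < e"
      using right[OF t e] by blast
    have "dist (W s) (W t) < e" if s: "s \<in> {lo..hi}" "dist s t < min d1 d2" for s
      using s t d1(2)[OF s(1)] d2(2)[OF s(1)] mono[of s t] mono[of t s]
      by (cases "s \<le> t") (auto simp: dist_real_def)
    then show "\<exists>d>0. \<forall>s\<in>{lo..hi}. dist s t < d \<longrightarrow> dist (W s) (W t) < e"
      using d1(1) d2(1) by (intro exI[of _ "min d1 d2"]) auto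
  qed
qed

section \<open>Incentive compatibility\<close>

text \<open>Obedience is written by applying u to the wage, which stays meaningful when the
  right-hand side exceeds the range of u. The monotonicity integral is oriented, hence the reversed
  sign when \<theta> < \<theta>'; integrability is stated separately because \<open>integral\<close>
  takes the value 0 on non-integrable functions.\<close>

theorem theorem1:
  fixes X :: "real set" and th_lo th_hi :: real
    and u :: "real \<Rightarrow> real"
    and C :: "real \<Rightarrow> real measure \<Rightarrow> real"
    and dC :: "real \<Rightarrow> real measure \<Rightarrow> real"
    and c :: "real \<Rightarrow> real measure \<Rightarrow> real \<Rightarrow> real"
    and w :: "real \<Rightarrow> real \<Rightarrow> real"
    and mu :: "real \<Rightarrow> real measure"
  assumes X: "(finite X \<and> X \<noteq> {}) \<or> (\<exists>a b. a \<le> b \<and> X = {a..b})"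
    and Theta: "th_lo < th_hi"
    and u_mono: "strict_mono u" and u_cont: "continuous_on UNIV u"
    and u_concave: "concave_on UNIV u"
    and C_bounded: "\<exists>B. \<forall>\<theta>\<in>{th_lo..th_hi}. \<forall>M\<in>Delta X. \<bar>C \<theta> M\<bar> \<le> B"
    and C_weak_cont: "\<forall>\<theta>\<in>{th_lo..th_hi}. \<forall>Ms M. (\<forall>n. Ms n \<in> Delta X) \<and> M \<in> Delta X
          \<and> weak_conv_on X Ms M \<longrightarrow> (\<lambda>n. C \<theta> (Ms n)) \<longlonglongrightarrow> C \<theta> M"
    and C_convex: "\<forall>\<theta>\<in>{th_lo..th_hi}. \<forall>M\<in>Delta X. \<forall>N\<in>Delta X. \<forall>a\<in>{0..1}.
          C \<theta> (mix X a M N) \<le> (1 - a) * C \<theta> M + a * C \<theta> N"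
    and C_fosd: "\<forall>\<theta>\<in>{th_lo..th_hi}. \<forall>M\<in>Delta X. \<forall>N\<in>Delta X.
          fosd X N M \<longrightarrow> C \<theta> N \<ge> C \<theta> M"
    and c_cont: "\<forall>\<theta>\<in>{th_lo..th_hi}. \<forall>M\<in>Delta X. continuous_on X (c \<theta> M)"
    and c_deriv: "\<forall>\<theta>\<in>{th_lo..th_hi}. \<forall>M\<in>Delta X. \<forall>N\<in>Delta X.
          ((\<lambda>\<epsilon>. (C \<theta> (mix X \<epsilon> M N) - C \<theta> M) / \<epsilon>) \<longlongrightarrow>
             ((\<integral>x. c \<theta> M x \<partial>N) - (\<integral>x. c \<theta> M x \<partial>M))) (at_right 0)"
    and C_decr: "\<forall>M\<in>Delta X. \<forall>s\<in>{th_lo..th_hi}. \<forall>t\<in>{th_lo..th_hi}. s < t \<longrightarrow> C t M < C s M"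
    and C_diff: "\<forall>M\<in>Delta X. \<forall>\<theta>\<in>{th_lo..th_hi}.
          ((\<lambda>t. C t M) has_real_derivative dC \<theta> M) (at \<theta> within {th_lo..th_hi})"
    and dC_cont: "\<forall>M\<in>Delta X. continuous_on {th_lo..th_hi} (\<lambda>t. dC t M)"
    and dC_bounded: "\<forall>\<theta>\<in>{th_lo..th_hi}. \<exists>B. \<forall>M\<in>Delta X. \<bar>dC \<theta> M\<bar> \<le> B"
    and w_meas: "\<forall>\<theta>\<in>{th_lo..th_hi}. w \<theta> \<in> borel_measurable (restrict_space borel X)"
    and w_bdd: "\<forall>\<theta>\<in>{th_lo..th_hi}. \<exists>B. \<forall>x\<in>X. w \<theta> x \<le> B"
    and w_mono: "\<forall>\<theta>\<in>{th_lo..th_hi}. mono_on X (w \<theta>)"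
    and w_rcont: "\<forall>\<theta>\<in>{th_lo..th_hi}. \<forall>x\<in>X. continuous (at x within ({x..} \<inter> X)) (w \<theta>)"
    and mu_Delta: "\<forall>\<theta>\<in>{th_lo..th_hi}. mu \<theta> \<in> Delta X"
  shows "(\<forall>\<theta>\<in>{th_lo..th_hi}. \<forall>\<theta>'\<in>{th_lo..th_hi}. \<forall>N\<in>Delta X.
            Util u C \<theta> (w \<theta>) (mu \<theta>) \<ge> Util u C \<theta> (w \<theta>') N)
     \<longleftrightarrow>
     (\<exists>(Mr :: real \<Rightarrow> real \<Rightarrow> real measure) (V :: real \<Rightarrow> real).
        (\<forall>\<theta>\<in>{th_lo..th_hi}. \<forall>\<theta>'\<in>{th_lo..th_hi}. Mr \<theta> \<theta>' \<in> Delta X) \<and>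
        (\<forall>\<theta>\<in>{th_lo..th_hi}. Mr \<theta> \<theta> = mu \<theta>) \<and>
        abs_cont_on th_lo th_hi V \<and>
        (\<forall>\<theta>\<in>{th_lo..th_hi}. V \<theta> = Util u C \<theta> (w \<theta>) (mu \<theta>)) \<and>
        (\<forall>\<theta>\<in>{th_lo..th_hi}.
           ((\<lambda>t. dC t (mu t)) has_integral (V th_lo - V \<theta>)) {th_lo..\<theta>} \<and>
           (\<forall>\<theta>'\<in>{th_lo..th_hi}.
              (\<lambda>t. - dC t (mu t) + dC t (Mr t \<theta>')) integrable_on {min \<theta> \<theta>'..max \<theta> \<theta>'} \<and>
              (if \<theta>' \<le> \<theta>
               then integral {\<theta>'..\<theta>} (\<lambda>t. - dC t (mu t) + dC t (Mr t \<theta>')) \<ge> 0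
               else integral {\<theta>..\<theta>'} (\<lambda>t. - dC t (mu t) + dC t (Mr t \<theta>')) \<le> 0)) \<and>
           (\<forall>x\<in>X. u (w \<theta> x) \<le> c \<theta> (mu \<theta>) x + V \<theta> + C \<theta> (mu \<theta>)
                                 - (\<integral>y. c \<theta> (mu \<theta>) y \<partial>(mu \<theta>))) \<and>
           (AE x in mu \<theta>. u (w \<theta> x) = c \<theta> (mu \<theta>) x + V \<theta> + C \<theta> (mu \<theta>)
                                 - (\<integral>y. c \<theta> (mu \<theta>) y \<partial>(mu \<theta>))) \<and>
           (\<forall>\<theta>'\<in>{th_lo..th_hi}. \<theta>' \<noteq> \<theta> \<longrightarrow>
              (\<forall>N\<in>Delta X. (\<integral>x. u (w \<theta>' x) - c \<theta> (Mr \<theta> \<theta>') x \<partial>N)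
                  \<le> (\<integral>x. u (w \<theta>' x) - c \<theta> (Mr \<theta> \<theta>') x \<partial>(Mr \<theta> \<theta>'))))))"
proof -

  \<comment> \<open>Best responses to a contract and their envelope formulas\<close>
  let ?I = "{th_lo..th_hi}"
  define f where "f \<theta> x = u (w \<theta> x)" for \<theta> x
  have Xc: "compact X" and Xne: "X \<noteq> {}" using X by (auto simp: finite_imp_compact)
  have fm: "f \<theta> \<in> borel_measurable (restrict_space borel X)" if "\<theta> \<in> ?I" for \<theta>
    unfolding f_def using w_meas that
    by (auto intro: measurable_compose[OF _ borel_measurable_continuous_onI[OF u_cont]])
  have fmono: "mono_on X (f \<theta>)" if "\<theta> \<in> ?I" for \<theta>
    unfolding f_def using w_mono that strict_mono_mono[OF u_mono]
    by (auto simp: mono_on_def mono_def)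
  have frc: "continuous (at x within ({x..} \<inter> X)) (f \<theta>)" if "\<theta> \<in> ?I" "x \<in> X" for \<theta> x
    unfolding f_def continuous_within
  proof (rule isCont_tendsto_compose[of _ u])
    show "isCont u (w \<theta> x)" using u_cont by (simp add: continuous_on_eq_continuous_at)
    show "(w \<theta> \<longlongrightarrow> w \<theta> x) (at x within {x..} \<inter> X)" using w_rcont that by (simp add: continuous_within)
  qed
  have "\<forall>\<theta>\<in>?I. \<exists>B. \<forall>x\<in>X. \<bar>f \<theta> x\<bar> \<le> B"
    using mono_on_compact_bounded[OF Xc Xne fmono] by metis
  then obtain Bf where fB: "\<And>\<theta> x. \<theta> \<in> ?I \<Longrightarrow> x \<in> X \<Longrightarrow> \<bar>f \<theta> x\<bar> \<le> Bf \<theta>" by metis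
  obtain BC where BC: "\<And>\<theta> M. \<theta> \<in> ?I \<Longrightarrow> M \<in> Delta X \<Longrightarrow> \<bar>C \<theta> M\<bar> \<le> BC"
    using C_bounded by blast
  \<comment> \<open>Best responses of type \<theta> to the contract meant for \<theta>'.\<close>
  define maxi where "maxi \<theta> \<theta>' M \<longleftrightarrow>
    M \<in> Delta X \<and> (\<forall>N\<in>Delta X. Util u C \<theta> (w \<theta>') N \<le> Util u C \<theta> (w \<theta>') M)" for \<theta> \<theta>' M
  have ex_max: "\<exists>M. maxi \<theta> \<theta>' M" if \<theta>: "\<theta> \<in> ?I" "\<theta>' \<in> ?I" for \<theta> \<theta>'
  proof -
    have weak: "(\<lambda>n. C \<theta> (Ms n)) \<longlonglongrightarrow> C \<theta> M"
      if "\<And>n. Ms n \<in> Delta X" "M \<in> Delta X" "weak_conv_on X Ms M" for Ms M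
      using C_weak_cont \<theta>(1) that by blast
    show ?thesis
      using exists_maximizer[OF Xc Xne fm[OF \<theta>(2)] fB[OF \<theta>(2)]
          mono_right_continuous_usc[OF fmono[OF \<theta>(2)] frc[OF \<theta>(2)]] weak BC[OF \<theta>(1)]]
      unfolding maxi_def Util_def f_def by (simp add: Bex_def)
  qed
  have maxi_iff: "maxi \<theta> \<theta>' M \<longleftrightarrow>
      (\<forall>N\<in>Delta X. (\<integral>x. f \<theta>' x - c \<theta> M x \<partial>N) \<le> (\<integral>x. f \<theta>' x - c \<theta> M x \<partial>M))"
    if \<theta>: "\<theta> \<in> ?I" "\<theta>' \<in> ?I" and M: "M \<in> Delta X" for \<theta> \<theta>' M
    using maximizer_iff_linearized[OF Xc M fm[OF \<theta>(2)] fB[OF \<theta>(2)], of "C \<theta>" "c \<theta> M"]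
      C_convex c_cont c_deriv \<theta> M unfolding maxi_def Util_def f_def[symmetric] by simp
  \<comment> \<open>The mean of u(w) - c under \<open>mu \<theta>\<close> equals V + C minus the
    mean of c, which turns the pointwise criterion for linear maximizers into on-path
    obedience.\<close>
  have on_path_iff: "maxi \<theta> \<theta> (mu \<theta>) \<longleftrightarrow>
      (\<forall>x\<in>X. u (w \<theta> x) \<le> c \<theta> (mu \<theta>) x + V + C \<theta> (mu \<theta>) - (\<integral>y. c \<theta> (mu \<theta>) y \<partial>mu \<theta>)) \<and>
      (AE x in mu \<theta>. u (w \<theta> x) = c \<theta> (mu \<theta>) x + V + C \<theta> (mu \<theta>) - (\<integral>y. c \<theta> (mu \<theta>) y \<partial>mu \<theta>))"
    if \<theta>: "\<theta> \<in> ?I" and V: "V = Util u C \<theta> (w \<theta>) (mu \<theta>)" for \<theta> V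
  proof -
    have M: "mu \<theta> \<in> Delta X" using mu_Delta \<theta> by blast
    have cc: "continuous_on X (c \<theta> (mu \<theta>))" using c_cont \<theta> M by blast
    obtain Bc where Bc: "\<And>x. x \<in> X \<Longrightarrow> \<bar>c \<theta> (mu \<theta>) x\<bar> \<le> Bc"
      and cm: "c \<theta> (mu \<theta>) \<in> borel_measurable (restrict_space borel X)"
      using compact_continuous_bounded_measurable[OF Xc cc] by metis
    have hB: "\<bar>f \<theta> x - c \<theta> (mu \<theta>) x\<bar> \<le> Bf \<theta> + Bc" if "x \<in> X" for x
      using fB[OF \<theta> that] Bc[OF that] by linarith
    have hm: "(\<lambda>x. f \<theta> x - c \<theta> (mu \<theta>) x) \<in> borel_measurable (restrict_space borel X)"
      using fm[OF \<theta>] cm by (rule borel_measurable_diff)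
    have "(\<integral>x. f \<theta> x - c \<theta> (mu \<theta>) x \<partial>mu \<theta>) = (\<integral>x. f \<theta> x \<partial>mu \<theta>) - (\<integral>x. c \<theta> (mu \<theta>) x \<partial>mu \<theta>)"
      using Delta_integrable[OF M fm[OF \<theta>] fB[OF \<theta>]] Delta_integrable_continuous[OF M Xc cc]
      by (rule Bochner_Integration.integral_diff)
    then have eq: "(\<integral>x. f \<theta> x - c \<theta> (mu \<theta>) x \<partial>mu \<theta>) = V + C \<theta> (mu \<theta>) - (\<integral>x. c \<theta> (mu \<theta>) x \<partial>mu \<theta>)"
      by (simp add: V Util_def f_def)
    show ?thesis
      using trans[OF maxi_iff[OF \<theta> \<theta> M] linear_maximizer_iff_pointwise[OF M hm hB]]
      unfolding eq by (simp add: f_def algebra_simps)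
  qed
  \<comment> \<open>W and the selection N stay general so that one fact covers both the truthful
    value and the value of a fixed report.\<close>
  have envelope: "abs_cont_on th_lo th_hi W"
      "\<And>a b. \<lbrakk>th_lo \<le> a; a \<le> b; b \<le> th_hi\<rbrakk> \<Longrightarrow> ((\<lambda>t. dC t (N t)) has_integral (W a - W b)) {a..b}"
    if N: "\<And>t. t \<in> ?I \<Longrightarrow> N t \<in> Delta X"
      and ineq: "\<And>s t. \<lbrakk>s \<in> ?I; t \<in> ?I\<rbrakk> \<Longrightarrow> W t - W s \<le> C s (N t) - C t (N t)" for W N
  proof -
    have anti: "C y M \<le> C x M" if "M \<in> Delta X" "th_lo \<le> x" "x \<le> y" "y \<le> th_hi" for M x y
      using C_decr that by (cases "x = y") (auto intro: less_imp_le)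
    have diff: "((\<lambda>s. C s M) has_real_derivative dC t M) (at t within ?I)"
      if "M \<in> Delta X" "t \<in> ?I" for M t using C_diff that by blast
    have "continuous_on ?I W"
    proof (rule envelope_continuous[where C = C and N = N and W = W, OF Xc N ineq anti])
      show "continuous_on ?I (\<lambda>t. C t M)" if "M \<in> Delta X" for M
        using diff[OF that] by (rule DERIV_continuous_on)
      show "(\<lambda>n. C t (Ms n)) \<longlonglongrightarrow> C t M"
        if "t \<in> ?I" "\<And>n. Ms n \<in> Delta X" "M \<in> Delta X" "weak_conv_on X Ms M" for t Ms M
        using C_weak_cont that by blast
    qed
    from envelope_abs_cont_has_integral[of th_lo th_hi W "\<lambda>t s. C s (N t)" "\<lambda>t. dC t (N t)",
        OF Theta ineq anti[OF N] diff[OF N] this]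
    show "abs_cont_on th_lo th_hi W"
      "\<And>a b. \<lbrakk>th_lo \<le> a; a \<le> b; b \<le> th_hi\<rbrakk> \<Longrightarrow> ((\<lambda>t. dC t (N t)) has_integral (W a - W b)) {a..b}"
      by auto
  qed
  \<comment> \<open>All types respond to one contract, so letting s choose the measure of t leaves
    the wage term unchanged and only the cost difference remains.\<close>
  have envelope_fixed: "((\<lambda>t. dC t (Mr t)) has_integral
        (Util u C a (w \<theta>') (Mr a) - Util u C b (w \<theta>') (Mr b))) {a..b}"
    if max: "\<And>t. t \<in> ?I \<Longrightarrow> maxi t \<theta>' (Mr t)" and ab: "th_lo \<le> a" "a \<le> b" "b \<le> th_hi" for \<theta>' Mr a b
  proof (rule envelope(2)[OF _ _ ab])
    fix s t assume s: "s \<in> ?I" and t: "t \<in> ?I"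
    have "Util u C s (w \<theta>') (Mr t) \<le> Util u C s (w \<theta>') (Mr s)"
      using max[OF s] max[OF t] unfolding maxi_def by blast
    then show "Util u C t (w \<theta>') (Mr t) - Util u C s (w \<theta>') (Mr s) \<le> C s (Mr t) - C t (Mr t)"
      by (simp add: Util_def)
  qed (use max in \<open>auto simp: maxi_def\<close>)
  show ?thesis (is "?IC \<longleftrightarrow> (\<exists>Mr V. ?D Mr V \<and> ?E Mr V \<and> ?A Mr V \<and> ?U Mr V \<and> ?B Mr V)")
  proof

    \<comment> \<open>Necessity: building the schedule from best responses\<close>
    assume IC: ?IC
    define V where "V \<theta> = Util u C \<theta> (w \<theta>) (mu \<theta>)" for \<theta>
    \<comment> \<open>The diagonal is prescribed; off it any best response serves.\<close>
    define Mr where "Mr \<theta> \<theta>' = (if \<theta> = \<theta>' then mu \<theta> else (SOME M. maxi \<theta> \<theta>' M))" for \<theta> \<theta>'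
    have Mr: "maxi \<theta> \<theta>' (Mr \<theta> \<theta>')" if "\<theta> \<in> ?I" "\<theta>' \<in> ?I" for \<theta> \<theta>'
    proof (cases "\<theta> = \<theta>'")
      case True then show ?thesis using IC mu_Delta that by (simp add: Mr_def maxi_def)
    next
      case False then show ?thesis using someI_ex[OF ex_max[OF that]] by (simp add: Mr_def)
    qed
    have MrD: "Mr \<theta> \<theta>' \<in> Delta X" if "\<theta> \<in> ?I" "\<theta>' \<in> ?I" for \<theta> \<theta>'
      using Mr[OF that] by (simp add: maxi_def)
    \<comment> \<open>Type s may take both the contract and the measure of t; the wage terms
      cancel.\<close>
    have ineq: "V t - V s \<le> C s (mu t) - C t (mu t)" if "s \<in> ?I" "t \<in> ?I" for s t
    proof -
      have "Util u C s (w t) (mu t) \<le> V s" using IC that mu_Delta by (simp add: V_def)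
      then show ?thesis by (simp add: V_def Util_def)
    qed
    have muD: "mu t \<in> Delta X" if "t \<in> ?I" for t using mu_Delta that by blast
    note envV = envelope[of mu V, OF muD ineq]
    \<comment> \<open>The value is the increase of V - W over [a, b], where W is the best value from
      reporting \<theta>'. Since V - W vanishes at \<theta>', an integral with one end there shows
      the sign of V - W at the other end.\<close>
    have gen: "((\<lambda>t. - dC t (mu t) + dC t (Mr t \<theta>')) has_integral
          - (V a - V b) + (Util u C a (w \<theta>') (Mr a \<theta>') - Util u C b (w \<theta>') (Mr b \<theta>'))) {a..b}"
      if "\<theta>' \<in> ?I" "th_lo \<le> a" "a \<le> b" "b \<le> th_hi" for \<theta>' a b
      using that Mr by (intro has_integral_add has_integral_neg envV(2) envelope_fixed) auto
    have diag: "Util u C \<theta> (w \<theta>) (Mr \<theta> \<theta>) = V \<theta>" for \<theta> by (simp add: Mr_def V_def)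
    have VW: "Util u C \<theta> (w \<theta>') (Mr \<theta> \<theta>') \<le> V \<theta>" if "\<theta> \<in> ?I" "\<theta>' \<in> ?I" for \<theta> \<theta>'
      using IC that MrD by (simp add: V_def)
    have monotonicity: "(\<lambda>t. - dC t (mu t) + dC t (Mr t \<theta>')) integrable_on {min \<theta> \<theta>'..max \<theta> \<theta>'} \<and>
              (if \<theta>' \<le> \<theta>
               then integral {\<theta>'..\<theta>} (\<lambda>t. - dC t (mu t) + dC t (Mr t \<theta>')) \<ge> 0
               else integral {\<theta>..\<theta>'} (\<lambda>t. - dC t (mu t) + dC t (Mr t \<theta>')) \<le> 0)"
      if \<theta>: "\<theta> \<in> ?I" "\<theta>' \<in> ?I" for \<theta> \<theta>'
    proof (cases "\<theta>' \<le> \<theta>")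
      case True
      have "((\<lambda>t. - dC t (mu t) + dC t (Mr t \<theta>')) has_integral
          - (V \<theta>' - V \<theta>) + (Util u C \<theta>' (w \<theta>') (Mr \<theta>' \<theta>') - Util u C \<theta> (w \<theta>') (Mr \<theta> \<theta>'))) {\<theta>'..\<theta>}"
        using \<theta> True by (intro gen) auto
      then show ?thesis using True VW[OF \<theta>] unfolding diag
        by (auto simp: has_integral_iff)
    next
      case False
      have "((\<lambda>t. - dC t (mu t) + dC t (Mr t \<theta>')) has_integral
          - (V \<theta> - V \<theta>') + (Util u C \<theta> (w \<theta>') (Mr \<theta> \<theta>') - Util u C \<theta>' (w \<theta>') (Mr \<theta>' \<theta>'))) {\<theta>..\<theta>'}"
        using \<theta> False by (intro gen) auto
      then show ?thesis using False VW[OF \<theta>] unfolding diag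
        by (auto simp: has_integral_iff)
    qed
    have on_path: "(\<forall>x\<in>X. u (w \<theta> x) \<le> c \<theta> (mu \<theta>) x + V \<theta> + C \<theta> (mu \<theta>) - (\<integral>y. c \<theta> (mu \<theta>) y \<partial>mu \<theta>)) \<and>
      (AE x in mu \<theta>. u (w \<theta> x) = c \<theta> (mu \<theta>) x + V \<theta> + C \<theta> (mu \<theta>) - (\<integral>y. c \<theta> (mu \<theta>) y \<partial>mu \<theta>))"
      if "\<theta> \<in> ?I" for \<theta>
      using Mr[OF that that] on_path_iff[OF that V_def] by (simp add: Mr_def)
    have off_path: "(\<integral>x. u (w \<theta>' x) - c \<theta> (Mr \<theta> \<theta>') x \<partial>N)
        \<le> (\<integral>x. u (w \<theta>' x) - c \<theta> (Mr \<theta> \<theta>') x \<partial>(Mr \<theta> \<theta>'))"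
      if "\<theta> \<in> ?I" "\<theta>' \<in> ?I" "N \<in> Delta X" for \<theta> \<theta>' N
      using Mr[OF that(1,2)] maxi_iff[OF that(1,2) MrD[OF that(1,2)]] that(3) by (simp add: f_def)
    show "\<exists>Mr V. ?D Mr V \<and> ?E Mr V \<and> ?A Mr V \<and> ?U Mr V \<and> ?B Mr V"
    proof (rule exI[of _ Mr], rule exI[of _ V], intro conjI ballI impI)
      show "Mr \<theta> \<theta> = mu \<theta>" for \<theta> by (simp add: Mr_def)
      show "V \<theta> = Util u C \<theta> (w \<theta>) (mu \<theta>)" for \<theta> by (simp add: V_def)
      show "((\<lambda>t. dC t (mu t)) has_integral V th_lo - V \<theta>) {th_lo..\<theta>}" if "\<theta> \<in> ?I" for \<theta>
        using that by (intro envV(2)) auto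
    qed (use MrD envV(1) monotonicity on_path off_path in blast)+
  next

    \<comment> \<open>Sufficiency: the truthful value dominates every misreport\<close>
    assume "\<exists>Mr V. ?D Mr V \<and> ?E Mr V \<and> ?A Mr V \<and> ?U Mr V \<and> ?B Mr V"
    then obtain Mr :: "real \<Rightarrow> real \<Rightarrow> real measure" and V :: "real \<Rightarrow> real"
      where D: "?D Mr V" and E: "?E Mr V" and U: "?U Mr V" and B: "?B Mr V"
      by (elim exE conjE) (rule that)
    have MrD: "Mr \<theta> \<theta>' \<in> Delta X" if "\<theta> \<in> ?I" "\<theta>' \<in> ?I" for \<theta> \<theta>'
      using D that by blast
    have Mr_diag: "Mr \<theta> \<theta> = mu \<theta>" if "\<theta> \<in> ?I" for \<theta>
      using E that by blast
    have V: "V \<theta> = Util u C \<theta> (w \<theta>) (mu \<theta>)" if "\<theta> \<in> ?I" for \<theta>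
      using U that by blast
    have env: "((\<lambda>t. dC t (mu t)) has_integral (V th_lo - V \<theta>)) {th_lo..\<theta>}" if "\<theta> \<in> ?I" for \<theta>
      using bspec[OF B that] by (elim conjE)
    have monotonicity: "if \<theta>' \<le> \<theta>
        then integral {\<theta>'..\<theta>} (\<lambda>t. - dC t (mu t) + dC t (Mr t \<theta>')) \<ge> 0
        else integral {\<theta>..\<theta>'} (\<lambda>t. - dC t (mu t) + dC t (Mr t \<theta>')) \<le> 0"
      if "\<theta> \<in> ?I" "\<theta>' \<in> ?I" for \<theta> \<theta>'
      using bspec[OF conjunct1[OF conjunct2[OF bspec[OF B that(1)]]] that(2)] by (elim conjE)
    have on_path: "(\<forall>x\<in>X. u (w \<theta> x) \<le> c \<theta> (mu \<theta>) x + V \<theta> + C \<theta> (mu \<theta>) - (\<integral>y. c \<theta> (mu \<theta>) y \<partial>mu \<theta>)) \<and>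
      (AE x in mu \<theta>. u (w \<theta> x) = c \<theta> (mu \<theta>) x + V \<theta> + C \<theta> (mu \<theta>) - (\<integral>y. c \<theta> (mu \<theta>) y \<partial>mu \<theta>))"
      if "\<theta> \<in> ?I" for \<theta>
      using bspec[OF B that] by (elim conjE) (intro conjI)
    have off_path: "\<forall>N\<in>Delta X. (\<integral>x. u (w \<theta>' x) - c \<theta> (Mr \<theta> \<theta>') x \<partial>N)
        \<le> (\<integral>x. u (w \<theta>' x) - c \<theta> (Mr \<theta> \<theta>') x \<partial>(Mr \<theta> \<theta>'))"
      if "\<theta> \<in> ?I" "\<theta>' \<in> ?I" "\<theta>' \<noteq> \<theta>" for \<theta> \<theta>'
      using bspec[OF B that(1)] that(2,3) by (elim conjE) (drule (1) bspec, drule (1) mp)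
    \<comment> \<open>On the diagonal the pointwise obedience condition yields the best response,
      elsewhere linearized optimality does.\<close>
    have Mr: "maxi \<theta> \<theta>' (Mr \<theta> \<theta>')" if "\<theta> \<in> ?I" "\<theta>' \<in> ?I" for \<theta> \<theta>'
    proof (cases "\<theta>' = \<theta>")
      case True
      then show ?thesis using on_path_iff[OF that(1) V[OF that(1)]] on_path[OF that(1)] Mr_diag[OF that(1)]
        by simp
    next
      case False
      then show ?thesis
        using maxi_iff[OF that MrD[OF that]] off_path[OF that False] by (simp add: f_def)
    qed
    \<comment> \<open>The envelope condition covers only intervals starting at \<open>th_lo\<close>;
      subtraction yields all subintervals.\<close>
    have envV: "((\<lambda>t. dC t (mu t)) has_integral (V a - V b)) {a..b}"
      if ab: "th_lo \<le> a" "a \<le> b" "b \<le> th_hi" for a b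
    proof -
      let ?g = "\<lambda>t. dC t (mu t)"
      have b: "(?g has_integral (V th_lo - V b)) {th_lo..b}" using ab by (intro env) auto
      have a: "(?g has_integral (V th_lo - V a)) {th_lo..a}" using ab by (intro env) auto
      have "?g integrable_on {a..b}"
        using integrable_on_subinterval[OF has_integral_integrable[OF b], of a b] ab by auto
      moreover have "integral {th_lo..a} ?g + integral {a..b} ?g = integral {th_lo..b} ?g"
        using ab b by (intro Henstock_Kurzweil_Integration.integral_combine has_integral_integrable) auto
      ultimately show ?thesis using integral_unique[OF a] integral_unique[OF b]
        by (simp add: has_integral_iff)
    qed
    \<comment> \<open>The formula for V is now assumed, while that for W follows from the best
      responses alone.\<close>
    have gen: "((\<lambda>t. - dC t (mu t) + dC t (Mr t \<theta>')) has_integral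
          - (V a - V b) + (Util u C a (w \<theta>') (Mr a \<theta>') - Util u C b (w \<theta>') (Mr b \<theta>'))) {a..b}"
      if "\<theta>' \<in> ?I" "th_lo \<le> a" "a \<le> b" "b \<le> th_hi" for \<theta>' a b
      using that Mr by (intro has_integral_add has_integral_neg envV envelope_fixed) auto
    show ?IC
    proof (intro ballI)
      fix \<theta> \<theta>' N assume \<theta>: "\<theta> \<in> ?I" "\<theta>' \<in> ?I" and N: "N \<in> Delta X"
      have diag: "Util u C \<theta>' (w \<theta>') (Mr \<theta>' \<theta>') = V \<theta>'" using Mr_diag[OF \<theta>(2)] V[OF \<theta>(2)] by simp
      have "Util u C \<theta> (w \<theta>') N \<le> Util u C \<theta> (w \<theta>') (Mr \<theta> \<theta>')"
        using Mr[OF \<theta>] N unfolding maxi_def by blast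
      \<comment> \<open>V and W agree at \<theta>', so generalized monotonicity makes V - W
        nonnegative at \<theta>.\<close>
      also have "\<dots> \<le> V \<theta>"
      proof (cases "\<theta>' \<le> \<theta>")
        case True
        then show ?thesis
          using monotonicity[OF \<theta>] integral_unique[OF gen[OF \<theta>(2), of \<theta>' \<theta>]] \<theta> diag by simp
      next
        case False
        then show ?thesis
          using monotonicity[OF \<theta>] integral_unique[OF gen[OF \<theta>(2), of \<theta> \<theta>']] \<theta> diag by simp
      qed
      finally show "Util u C \<theta> (w \<theta>) (mu \<theta>) \<ge> Util u C \<theta> (w \<theta>') N" using V[OF \<theta>(1)] by simp
    qed
  qed
qed

end
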